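(* There is a polynomial-time $3.46$-approximation algorithm for the unweighted stochastic matching problem in general graphs.
   Context: Stochastic matching problem (edge-probing model). An instance consists of an undirected graph $G=(V,E)$, a probability $p_e\in[0,1]$ for every edge $e$, and a positive integer patience $t_v$ for every vertex $v$. Each edge $e$ is independently present with probability $p_e$, revealed only when $e$ is probed. A (possibly adaptive) strategy repeatedly selects a not-yet-probed edge $e=(u,v)$ with $u,v$ both unmatched and both with positive remaining patience (initially $t_u,t_v$) and probes it: with probability $p_e$ the edge is present and is irrevocably added to the matching ($u,v$ become matched); otherwise the remaining patience of $u$ and of $v$ decreases by $1$. In the unweighted problem the value of a strategy is the expected number of matched edges. An $\alpha$-approximation algorithm produces on every instance a strategy of expected value at least $1/\alpha$ times the maximum expected value over all adaptive strategies (which likewise learn edge presence only by probing). *)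

theory Defs
  imports
    "HOL-Probability.Product_PMF"
    "HOL-Library.Log_Nat"
    "HOL-Computational_Algebra.Polynomial"
begin

section \<open>Stochastic matching\<close>

record 'v sm_instance =
  verts :: "'v set"
  edges :: "'v set set"
  prob :: "'v set \<Rightarrow> real"
  patience :: "'v \<Rightarrow> nat"

definition sm_wf :: "'v sm_instance \<Rightarrow> bool" where
  "sm_wf I \<longleftrightarrow> finite (verts I) \<and>
     (\<forall>e\<in>edges I. e \<subseteq> verts I \<and> card e = 2) \<and>
     (\<forall>e\<in>edges I. 0 \<le> prob I e \<and> prob I e \<le> 1) \<and>
     (\<forall>v\<in>verts I. patience I v > 0)"

text \<open>The probes made so far, oldest first, each with its outcome (edge present or not).\<close>

type_synonym 'v history = "('v set \<times> bool) list"

definition matching :: "'v history \<Rightarrow> 'v set set" where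
  "matching h = {e. (e, True) \<in> set h}"

definition failed_probes :: "'v history \<Rightarrow> 'v \<Rightarrow> nat" where
  "failed_probes h v = length (filter (\<lambda>(e, b). v \<in> e \<and> \<not> b) h)"

definition probeable :: "'v sm_instance \<Rightarrow> 'v history \<Rightarrow> 'v set \<Rightarrow> bool" where
  "probeable I h e \<longleftrightarrow> e \<in> edges I \<and> e \<notin> fst ` set h \<and>
     (\<forall>v\<in>e. v \<notin> \<Union>(matching h) \<and> failed_probes h v < patience I v)"

inductive legal :: "'v sm_instance \<Rightarrow> 'v history \<Rightarrow> bool" for I where
  legal_Nil: "legal I []"
| legal_snoc: "legal I h \<Longrightarrow> probeable I h e \<Longrightarrow> legal I (h @ [(e, b)])"

text \<open>An adaptive strategy chooses the next edge to probe, or stops, knowing only the history.\<close>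

type_synonym 'v strategy = "'v history \<Rightarrow> 'v set option"

definition valid_strategy :: "'v sm_instance \<Rightarrow> 'v strategy \<Rightarrow> bool" where
  "valid_strategy I \<sigma> \<longleftrightarrow> (\<forall>h e. legal I h \<longrightarrow> \<sigma> h = Some e \<longrightarrow> probeable I h e)"

definition probe_step :: "'v strategy \<Rightarrow> ('v set \<Rightarrow> bool) \<Rightarrow> 'v history \<Rightarrow> 'v history" where
  "probe_step \<sigma> \<omega> h = (case \<sigma> h of None \<Rightarrow> h | Some e \<Rightarrow> h @ [(e, \<omega> e)])"

text \<open>As no edge is probed twice, a valid strategy has stopped after one step per edge.\<close>

definition run_strategy :: "'v sm_instance \<Rightarrow> 'v strategy \<Rightarrow> ('v set \<Rightarrow> bool) \<Rightarrow> 'v history" where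
  "run_strategy I \<sigma> \<omega> = (probe_step \<sigma> \<omega> ^^ card (edges I)) []"

lemma legal_card:
  assumes "legal I h"
  shows "length h = card (fst ` set h) \<and> fst ` set h \<subseteq> edges I"
  using assms by induction (auto simp: probeable_def)

lemma run_strategy_stopped:
  assumes "sm_wf I" "valid_strategy I \<sigma>"
  shows "legal I (run_strategy I \<sigma> \<omega>) \<and> \<sigma> (run_strategy I \<sigma> \<omega>) = None"
proof -
  have fin: "finite (edges I)"
    using assms(1) by (auto simp: sm_wf_def intro: finite_subset[of _ "Pow (verts I)"])
  let ?h = "\<lambda>k. (probe_step \<sigma> \<omega> ^^ k) []"
  have inv: "legal I (?h k) \<and> (\<sigma> (?h k) = None \<or> length (?h k) = k)" for k
  proof (induction k)
    case (Suc k)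
    have "legal I (probe_step \<sigma> \<omega> h) \<and>
        (\<sigma> (probe_step \<sigma> \<omega> h) = None \<or> length (probe_step \<sigma> \<omega> h) = Suc k)"
      if "legal I h \<and> (\<sigma> h = None \<or> length h = k)" for h
      using assms(2) that by (cases "\<sigma> h")
        (auto simp: probe_step_def valid_strategy_def intro: legal_snoc)
    from this[OF Suc] show ?case by simp
  qed (auto intro: legal_Nil)
  have "\<sigma> h = None" if "legal I h" "length h = card (edges I)" for h
  proof (rule ccontr)
    assume "\<sigma> h \<noteq> None"
    then obtain e where "\<sigma> h = Some e" by blast
    then have "probeable I h e"
      using assms(2) that(1) by (simp add: valid_strategy_def)
    moreover have "fst ` set h = edges I"
      using legal_card[OF that(1)] that(2) fin by (intro card_subset_eq) auto
    ultimately show False by (auto simp: probeable_def)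
  qed
  then show ?thesis
    using inv[of "card (edges I)"] unfolding run_strategy_def by blast
qed

definition realization :: "'v sm_instance \<Rightarrow> ('v set \<Rightarrow> bool) pmf" where
  "realization I = Pi_pmf (edges I) False (\<lambda>e. bernoulli_pmf (prob I e))"

definition strategy_value :: "'v sm_instance \<Rightarrow> 'v strategy \<Rightarrow> real" where
  "strategy_value I \<sigma> =
     measure_pmf.expectation (realization I) (\<lambda>\<omega>. real (card (matching (run_strategy I \<sigma> \<omega>))))"


section \<open>Random access machine with logarithmic cost\<close>

text \<open>
  Structured programs over a random access machine: registers, addressed only by constants, and a
  memory, addressed indirectly through registers, all holding natural numbers of any size.
  Following the logarithmic cost criterion, every access is charged the bit length of the numbers
  and addresses it touches, so that polynomial time here is polynomial time on Turing machines.
\<close>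

datatype operand = Const nat | Reg nat | Mem nat  \<comment> \<open>\<open>Mem i\<close>: the cell whose address is in register \<open>i\<close>\<close>

datatype arith = Add | Sub | Mul | Div

datatype dest = ToReg nat | ToMem nat

datatype com =
    Skip
  | Assign dest arith operand operand
  | Seq com com
  | Cond operand com com
  | While operand com

type_synonym ram = "(nat \<Rightarrow> nat) \<times> (nat \<Rightarrow> nat)"  \<comment> \<open>registers and memory\<close>

definition bit_length :: "nat \<Rightarrow> nat" where
  "bit_length n = max 1 (floorlog 2 n)"

fun operand_val :: "ram \<Rightarrow> operand \<Rightarrow> nat" where
  "operand_val (r, m) (Const k) = k"
| "operand_val (r, m) (Reg i) = r i"
| "operand_val (r, m) (Mem i) = m (r i)"

fun operand_cost :: "ram \<Rightarrow> operand \<Rightarrow> nat" where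
  "operand_cost (r, m) (Const k) = bit_length k"
| "operand_cost (r, m) (Reg i) = bit_length i + bit_length (r i)"
| "operand_cost (r, m) (Mem i) = bit_length i + bit_length (r i) + bit_length (m (r i))"

fun dest_cost :: "ram \<Rightarrow> dest \<Rightarrow> nat" where
  "dest_cost (r, m) (ToReg i) = bit_length i"
| "dest_cost (r, m) (ToMem i) = bit_length i + bit_length (r i)"

fun store :: "ram \<Rightarrow> dest \<Rightarrow> nat \<Rightarrow> ram" where
  "store (r, m) (ToReg i) x = (r(i := x), m)"
| "store (r, m) (ToMem i) x = (r, m(r i := x))"

text \<open>\<open>Sub\<close> truncates at zero, which also provides comparisons; \<open>Div\<close> by zero yields zero.\<close>

fun arith_val :: "arith \<Rightarrow> nat \<Rightarrow> nat \<Rightarrow> nat" where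
  "arith_val Add x y = x + y"
| "arith_val Sub x y = x - y"
| "arith_val Mul x y = x * y"
| "arith_val Div x y = x div y"

text \<open>\<open>exec c s T s'\<close>: started in \<open>s\<close>, the program \<open>c\<close> halts in \<open>s'\<close> at total cost \<open>T\<close>.\<close>

inductive exec :: "com \<Rightarrow> ram \<Rightarrow> nat \<Rightarrow> ram \<Rightarrow> bool" where
  exec_Skip: "exec Skip s 1 s"
| exec_Assign: "exec (Assign d f x y) s (dest_cost s d + operand_cost s x + operand_cost s y)
     (store s d (arith_val f (operand_val s x) (operand_val s y)))"
| exec_Seq: "exec c1 s T1 s1 \<Longrightarrow> exec c2 s1 T2 s2 \<Longrightarrow> exec (Seq c1 c2) s (T1 + T2) s2"
| exec_CondTrue: "operand_val s x \<noteq> 0 \<Longrightarrow> exec c1 s T s1 \<Longrightarrow>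
     exec (Cond x c1 c2) s (operand_cost s x + T) s1"
| exec_CondFalse: "operand_val s x = 0 \<Longrightarrow> exec c2 s T s1 \<Longrightarrow>
     exec (Cond x c1 c2) s (operand_cost s x + T) s1"
| exec_WhileFalse: "operand_val s x = 0 \<Longrightarrow> exec (While x c) s (operand_cost s x) s"
| exec_WhileTrue: "operand_val s x \<noteq> 0 \<Longrightarrow> exec c s T1 s1 \<Longrightarrow> exec (While x c) s1 T2 s2 \<Longrightarrow>
     exec (While x c) s (operand_cost s x + T1 + T2) s2"

inductive_cases SkipE: "exec Skip s T s'"
inductive_cases AssignE: "exec (Assign d f x y) s T s'"
inductive_cases SeqE: "exec (Seq c1 c2) s T s'"
inductive_cases CondE: "exec (Cond x c1 c2) s T s'"
inductive_cases WhileE: "exec (While x c) s T s'"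

lemma exec_deterministic:
  assumes "exec c s T r" "exec c s T' r'"
  shows "T' = T \<and> r' = r"
  using assms
proof (induction arbitrary: T' r' rule: exec.induct)
  case (exec_Seq c1 s T1 s1 c2 T2 s2)
  obtain U1 U2 z where "exec c1 s U1 z" "exec c2 z U2 r'" "T' = U1 + U2"
    using exec_Seq.prems by (rule SeqE)
  then show ?case using exec_Seq.IH by metis
next
  case (exec_CondTrue s x c1 T s1 c2)
  obtain U where "exec c1 s U r'" "T' = operand_cost s x + U"
    using exec_CondTrue.prems by (rule CondE) (use exec_CondTrue.hyps(1) in blast)+
  then show ?case using exec_CondTrue.IH by metis
next
  case (exec_CondFalse s x c2 T s1 c1)
  obtain U where "exec c2 s U r'" "T' = operand_cost s x + U"
    using exec_CondFalse.prems by (rule CondE) (use exec_CondFalse.hyps(1) in auto)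
  then show ?case using exec_CondFalse.IH by metis
next
  case (exec_WhileTrue s x c T1 s1 T2 s2)
  obtain U1 U2 z where "exec c s U1 z" "exec (While x c) z U2 r'"
      "T' = operand_cost s x + U1 + U2"
    using exec_WhileTrue.prems by (rule WhileE) (use exec_WhileTrue.hyps(1) in blast)+
  then show ?case using exec_WhileTrue.IH by metis
qed (erule SkipE, simp, erule AssignE, simp, erule WhileE, simp_all)

definition initial_ram :: "nat list \<Rightarrow> ram" where
  "initial_ram xs = (\<lambda>_. 0, \<lambda>i. if i < length xs then xs ! i else 0)"

definition bit_size :: "nat list \<Rightarrow> nat" where
  "bit_size xs = (\<Sum>x\<leftarrow>xs. bit_length x)"


section \<open>Algorithms for stochastic matching\<close>

text \<open>
  A description lists the patiences of the vertices \<open>0, \<dots>, n - 1\<close> and, in any order, the edges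
  as tuples \<open>(u, v, a, b)\<close>, for an edge \<open>u < v\<close> with probability \<open>a / b\<close>.
\<close>

type_synonym description = "nat list \<times> (nat \<times> nat \<times> nat \<times> nat) list"

definition describes :: "description \<Rightarrow> nat sm_instance \<Rightarrow> bool" where
  "describes D I \<longleftrightarrow> (case D of (ts, es) \<Rightarrow>
     verts I = {..<length ts} \<and> (\<forall>v<length ts. patience I v = ts ! v) \<and>
     edges I = (\<lambda>(u, v, a, b). {u, v}) ` set es \<and>
     distinct (map (\<lambda>(u, v, a, b). (u, v)) es) \<and>
     (\<forall>(u, v, a, b)\<in>set es. u < v \<and> b > 0 \<and> prob I {u, v} = real a / real b))"

lemma describes_exists:
  assumes wf: "sm_wf I" and V: "verts I = {..<n}" and rat: "\<forall>e\<in>edges I. prob I e \<in> \<rat>"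
  shows "\<exists>D. describes D I"
proof -
  have "finite (edges I)"
    using wf by (auto simp: sm_wf_def intro: finite_subset[of _ "Pow (verts I)"])
  then obtain xs where xs: "set xs = edges I" "distinct xs"
    using finite_distinct_list by blast
  define P where "P e q \<longleftrightarrow> (case q of (u, v, a, b) \<Rightarrow>
      u < v \<and> e = {u, v} \<and> b > 0 \<and> prob I e = real a / real b)"
    for e :: "nat set" and q :: "nat \<times> nat \<times> nat \<times> nat"
  have "\<exists>q. P e q" if "e \<in> edges I" for e
  proof -
    have c: "card e = 2" and p: "0 \<le> prob I e" "prob I e \<in> \<rat>"
      using wf rat that by (auto simp: sm_wf_def)
    obtain x y where "e = {x, y}" "x \<noteq> y"
      using c by (auto simp: card_2_iff)
    then obtain u v where uv: "u < v" "e = {u, v}"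
      by (metis insert_commute linorder_neqE_nat)
    obtain a b :: nat where "b \<noteq> 0" "\<bar>prob I e\<bar> = real a / real b"
      using p(2) by (rule Rats_abs_nat_div_natE)
    then have "P e (u, v, a, b)"
      using uv p(1) by (simp add: P_def)
    then show ?thesis ..
  qed
  then have "\<exists>g. \<forall>e\<in>edges I. P e (g e)"
    by (intro bchoice) blast
  then obtain g where g: "\<And>e. e \<in> edges I \<Longrightarrow> P e (g e)"
    by blast
  have inv: "(\<lambda>(u, v). {u, v}) ((\<lambda>(u, v, a, b). (u, v)) q) = e"
      "(\<lambda>(u, v, a, b). {u, v}) q = e" if "P e q" for e q
    using that by (auto simp: P_def)
  have "describes (map (patience I) [0..<n], map g xs) I"
    unfolding describes_def prod.case
  proof (intro conjI)
    have "(\<lambda>(u, v, a, b). {u, v}) ` set (map g xs) = (\<lambda>e. e) ` edges I"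
      unfolding set_map image_image xs(1) by (rule image_cong[OF refl], rule inv(2), rule g)
    then show "edges I = (\<lambda>(u, v, a, b). {u, v}) ` set (map g xs)" by simp
    have "inj_on ((\<lambda>(u, v, a, b). (u, v)) \<circ> g) (edges I)"
    proof (rule inj_on_inverseI)
      show "(\<lambda>(u, v). {u, v}) (((\<lambda>(u, v, a, b). (u, v)) \<circ> g) e) = e" if "e \<in> edges I" for e
        unfolding comp_apply by (rule inv(1)[OF g[OF that]])
    qed
    then show "distinct (map (\<lambda>(u, v, a, b). (u, v)) (map g xs))"
      using xs by (simp add: distinct_map comp_def)
    show "\<forall>(u, v, a, b)\<in>set (map g xs). u < v \<and> b > 0 \<and> prob I {u, v} = real a / real b"
    proof
      fix q assume "q \<in> set (map g xs)"
      then obtain e where "P e q" using xs(1) g by auto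
      then show "case q of (u, v, a, b) \<Rightarrow> u < v \<and> b > 0 \<and> prob I {u, v} = real a / real b"
        by (auto simp: P_def)
    qed
  qed (use V in auto)
  then show ?thesis by blast
qed

fun encode_description :: "description \<Rightarrow> nat list" where
  "encode_description (ts, es) =
     [length ts, length es] @ ts @ concat (map (\<lambda>(u, v, a, b). [u, v, a, b]) es)"

definition encode_history :: "nat history \<Rightarrow> nat list" where
  "encode_history h = length h # concat (map (\<lambda>(e, b). [Min e, Max e, of_bool b]) h)"

text \<open>Register 0 tells whether to probe a further edge, registers 1 and 2 hold its endpoints.\<close>

definition decode_action :: "ram \<Rightarrow> nat set option" where
  "decode_action s = (case s of (r, m) \<Rightarrow> if r 0 = 0 then None else Some {r 1, r 2})"

text \<open>
  An algorithm is a program that, given the description of an instance and the history so far,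
  computes the next action. \<open>next_action c D h a T\<close>: this action is \<open>a\<close>, computed at cost \<open>T\<close>.
\<close>

definition next_action ::
    "com \<Rightarrow> description \<Rightarrow> nat history \<Rightarrow> nat set option \<Rightarrow> nat \<Rightarrow> bool" where
  "next_action c D h a T \<longleftrightarrow>
     (\<exists>s. exec c (initial_ram (encode_description D @ encode_history h)) T s \<and> decode_action s = a)"

text \<open>
  The bound is in the size of the instance alone. As an instance with \<open>m\<close> edges needs at most
  \<open>m + 1\<close> actions, it bounds the time of the whole run polynomially as well.
\<close>

definition polynomial_time :: "com \<Rightarrow> bool" where
  "polynomial_time c \<longleftrightarrow> (\<exists>q :: nat poly. \<forall>D I h. sm_wf I \<longrightarrow> describes D I \<longrightarrow> legal I h \<longrightarrow>
     (\<exists>a T. next_action c D h a T \<and> T \<le> poly q (bit_size (encode_description D))))"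

definition approximation_algorithm :: "real \<Rightarrow> com \<Rightarrow> bool" where
  "approximation_algorithm \<alpha> c \<longleftrightarrow> (\<forall>D I. sm_wf I \<longrightarrow> describes D I \<longrightarrow>
     (\<exists>\<sigma>. (\<forall>h. legal I h \<longrightarrow> (\<exists>T. next_action c D h (\<sigma> h) T)) \<and> valid_strategy I \<sigma> \<and>
        (\<forall>\<tau>. valid_strategy I \<tau> \<longrightarrow> strategy_value I \<sigma> \<ge> 1 / \<alpha> * strategy_value I \<tau>)))"

end

theory Submission
  imports Defs
begin

text \<open>
  The algorithm is greedy: it probes a probeable edge \<open>e\<close> of maximal probability \<open>p\<close>. This is even a
  2-approximation. A state consists of the unprobed edges and the residual patiences, where being
  matched amounts to having no patience left; let \<open>V\<close> be the optimal value of a state. Writing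
  \<open>V\<^sub>1\<close> and \<open>V\<^sub>0\<close> for the optimal values after \<open>e\<close> was found present and absent, the key inequality
  is \<open>V \<le> 2 p + p V\<^sub>1 + (1 - p) V\<^sub>0\<close>, whereas greedy gains \<open>p\<close> in this step. It is proved by induction
  on the first probe of an optimal strategy; when that probe uses up an endpoint of \<open>e\<close>, only the
  other endpoint matters, for which \<open>V \<le> p + p V\<^sub>1 + (1 - p) V\<^sub>0\<close> holds with \<open>V\<^sub>1\<close> and \<open>V\<^sub>0\<close> referring
  to that endpoint alone. The greedy choice is found by scanning the history once for every edge.
\<close>

section \<open>The loss caused by a greedy probe\<close>

text \<open>The key inequality compares the optimum with one that must first suffer the probe of
  \<open>e\<close> and gets no credit for it. Probing \<open>f\<close> commutes with that concession
  unless \<open>f\<close> and \<open>e\<close> share a vertex. In that case, after \<open>e\<close>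
  was found present, \<open>f\<close> can no longer be probed: a gain of \<open>p f\<close> is
  missing with probability \<open>p e\<close>. The other branch makes up for it: once
  \<open>f\<close> is present, only one endpoint of \<open>e\<close> is left to lose, which saves
  \<open>p e\<close> with probability \<open>p f\<close>. Both amounts are \<open>p e * p f\<close>,
  so the books balance exactly.

  For the machine, the obstacle is that a bound on bit lengths grows by a constant factor with every
  pass through loop-free code, which would compound exponentially over a loop. Every loop invariant
  therefore restates one fixed bound on all registers, proved from the meaning of their contents and
  not from the growth of the code.\<close>

definition exhaust :: "'v set \<Rightarrow> ('v \<Rightarrow> nat) \<Rightarrow> 'v \<Rightarrow> nat" where
  "exhaust e t v = (if v \<in> e then 0 else t v)"

text \<open>Like \<open>exhaust\<close>, this takes an arbitrary vertex set, so that a singleton can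
  model a probe felt by one endpoint only.\<close>

definition spend :: "'v set \<Rightarrow> ('v \<Rightarrow> nat) \<Rightarrow> 'v \<Rightarrow> nat" where
  "spend e t v = (if v \<in> e then t v - 1 else t v)"

abbreviation live :: "('v \<Rightarrow> nat) \<Rightarrow> 'v set \<Rightarrow> bool" where
  "live t e \<equiv> \<forall>v\<in>e. 0 < t v"

lemma exhaust_mono: "t \<le> t' \<Longrightarrow> exhaust e t \<le> exhaust e t'"
  by (auto simp: le_fun_def exhaust_def)

lemma spend_mono: "t \<le> t' \<Longrightarrow> spend e t \<le> spend e t'"
  by (auto simp: le_fun_def spend_def intro: diff_le_mono)

lemma exhaust_le: "exhaust e t \<le> t" and spend_le: "spend e t \<le> t"
  by (auto simp: le_fun_def exhaust_def spend_def)

lemma live_mono: "t \<le> t' \<Longrightarrow> live t e \<Longrightarrow> live t' e"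
  by (metis le_funD less_le_trans)

lemma exhaust_spend_subset: "A \<subseteq> B \<Longrightarrow> exhaust B (spend A t) = exhaust B t"
  by (auto simp: fun_eq_iff exhaust_def spend_def)

lemma exhaust_commute: "exhaust A (exhaust B t) = exhaust B (exhaust A t)"
  by (auto simp: fun_eq_iff exhaust_def)

lemma spend_commute: "spend A (spend B t) = spend B (spend A t)"
  by (auto simp: fun_eq_iff spend_def)

lemma exhaust_spend_commute: "A \<inter> B = {} \<Longrightarrow> exhaust A (spend B t) = spend B (exhaust A t)"
  by (auto simp: fun_eq_iff spend_def exhaust_def)

text \<open>The 0 in the maximum is the option to stop. The test \<open>e \<in> S\<close> inside the
  image supplies the fact from which termination concludes that \<open>card S\<close> drops.\<close>

function opt_value :: "('v set \<Rightarrow> real) \<Rightarrow> 'v set set \<Rightarrow> ('v \<Rightarrow> nat) \<Rightarrow> real" where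
  "opt_value p S t = (if finite S then
     Max (insert 0 ((\<lambda>e. if e \<in> S \<and> live t e then
       p e * (1 + opt_value p (S - {e}) (exhaust e t)) + (1 - p e) * opt_value p (S - {e}) (spend e t)
       else 0) ` S)) else 0)"
  by pat_completeness auto
termination
  by (relation "Wellfounded.measure (\<lambda>(p, S, t). card S)") (auto intro!: diff_less simp: card_gt_0_iff)

declare opt_value.simps [simp del]

locale weighted_edges =
  fixes U :: "'v set set" and p :: "'v set \<Rightarrow> real"
  assumes finite_U: "finite U" and card_U: "e \<in> U \<Longrightarrow> card e = 2"
    and p_nonneg: "e \<in> U \<Longrightarrow> 0 \<le> p e" and p_le_1: "e \<in> U \<Longrightarrow> p e \<le> 1"
begin

abbreviation V :: "'v set set \<Rightarrow> ('v \<Rightarrow> nat) \<Rightarrow> real" where "V \<equiv> opt_value p"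

definition probe_value :: "'v set set \<Rightarrow> ('v \<Rightarrow> nat) \<Rightarrow> 'v set \<Rightarrow> real" where
  "probe_value S t e = p e * (1 + V (S - {e}) (exhaust e t)) + (1 - p e) * V (S - {e}) (spend e t)"

lemma V_eq:
  assumes "S \<subseteq> U"
  shows "V S t = Max (insert 0 ((\<lambda>e. if live t e then probe_value S t e else 0) ` S))"
proof -
  have "(\<lambda>e. if e \<in> S \<and> live t e then
       p e * (1 + V (S - {e}) (exhaust e t)) + (1 - p e) * V (S - {e}) (spend e t) else 0) ` S
     = (\<lambda>e. if live t e then probe_value S t e else 0) ` S"
    by (rule image_cong[OF refl]) (simp only: probe_value_def simp_thms)
  moreover have "finite S" using assms finite_U by (rule finite_subset)
  ultimately show ?thesis
    by (subst opt_value.simps) simp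
qed

lemma finite_probe_values:
  "S \<subseteq> U \<Longrightarrow> finite (insert 0 ((\<lambda>e. if live t e then probe_value S t e else 0) ` S))"
  using finite_subset[OF _ finite_U] by blast

lemma V_nonneg: "S \<subseteq> U \<Longrightarrow> 0 \<le> V S t"
  unfolding V_eq by (rule Max_ge[OF finite_probe_values]) simp_all

lemma probe_value_le_V: "S \<subseteq> U \<Longrightarrow> e \<in> S \<Longrightarrow> live t e \<Longrightarrow> probe_value S t e \<le> V S t"
  unfolding V_eq by (rule Max_ge[OF finite_probe_values], assumption, rule insertI2, rule image_eqI[where x = e]) simp_all

text \<open>The case distinction on the first probe of an optimal strategy, used by the inductions
  of this locale; \<open>0 \<le> B\<close> covers stopping at once.\<close>

lemma V_le:
  assumes "S \<subseteq> U" "0 \<le> B" "\<And>e. e \<in> S \<Longrightarrow> live t e \<Longrightarrow> probe_value S t e \<le> B"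
  shows "V S t \<le> B"
  unfolding V_eq[OF assms(1)]
proof (rule Max.boundedI)
qed (use finite_probe_values assms in \<open>auto split: if_splits\<close>)

lemma probe_value_mono:
  assumes "e \<in> U" "V (S - {e}) (exhaust e t) \<le> x" "V (S - {e}) (spend e t) \<le> y"
  shows "probe_value S t e \<le> p e * (1 + x) + (1 - p e) * y"
  unfolding probe_value_def using assms p_nonneg[of e] p_le_1[of e]
  by (intro add_mono mult_left_mono) auto

text \<open>A probe available in the smaller state is available in the larger one, and both outcomes
  lead to states that are ordered again.\<close>

lemma V_mono:
  assumes "S \<subseteq> S'" "S' \<subseteq> U" "t \<le> t'"
  shows "V S t \<le> V S' t'"
  using assms
proof (induction "card S" arbitrary: S S' t t' rule: less_induct)
  case less
  note prems = less.prems
  have SU: "S \<subseteq> U" using prems(1,2) by (rule subset_trans)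
  have fin: "finite S" using SU finite_U by (rule finite_subset)
  show ?case
  proof (rule V_le[OF SU V_nonneg[OF prems(2)]])
    fix e assume e: "e \<in> S" "live t e"
    have c: "card (S - {e}) < card S" using fin e(1) by (rule card_Diff1_less)
    have l: "live t' e" using prems(3) e(2) by (rule live_mono)
    have sub: "S - {e} \<subseteq> S' - {e}" "S' - {e} \<subseteq> U" using prems(1,2) by blast+
    have "probe_value S t e \<le> probe_value S' t' e"
      unfolding probe_value_def[of S' t']
      using e(1) SU less.hyps[OF c sub exhaust_mono[OF prems(3)]] less.hyps[OF c sub spend_mono[OF prems(3)]]
      by (intro probe_value_mono) blast+
    also have "\<dots> \<le> V S' t'"
      using e(1) prems(1) by (intro probe_value_le_V[OF prems(2) _ l]) blast
    finally show "probe_value S t e \<le> V S' t'" .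
  qed
qed

text \<open>Patience never grows, so a dead edge stays dead in every later state.\<close>

lemma V_remove_dead:
  assumes "S \<subseteq> U" "\<not> live t e"
  shows "V S t \<le> V (S - {e}) t"
  using assms
proof (induction "card S" arbitrary: S t rule: less_induct)
  case less
  have fin: "finite S" using less.prems finite_U finite_subset by blast
  show ?case
  proof (rule V_le)
    fix f assume f: "f \<in> S" "live t f"
    have c: "card (S - {f}) < card S" using fin f(1) by (rule card_Diff1_less)
    have "f \<noteq> e" using f less.prems by blast
    have s: "S - {e} - {f} = S - {f} - {e}" by auto
    have "probe_value S t f \<le> probe_value (S - {e}) t f"
      unfolding probe_value_def[of "S - {e}"] s
      using f less.prems
      using live_mono[OF exhaust_le[of f t], of e] live_mono[OF spend_le[of f t], of e]
      by (intro probe_value_mono less.hyps[OF c]) blast+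
    also have "\<dots> \<le> V (S - {e}) t"
      using f \<open>f \<noteq> e\<close> less.prems by (intro probe_value_le_V) auto
    finally show "probe_value S t f \<le> V (S - {e}) t" .
  qed (use less.prems in \<open>auto intro!: V_nonneg\<close>)
qed

text \<open>The right-hand side describes a fictitious probe at \<open>b\<close> alone, present with
  probability \<open>P\<close>; it uses no edge, hence \<open>S\<close> stays. If the first real
  probe \<open>f\<close> misses \<open>b\<close>, the two probes commute. If it meets
  \<open>b\<close>, the branch with \<open>f\<close> present has nothing further to lose at
  \<open>b\<close>, and the branch with \<open>f\<close> absent is left to the induction
  hypothesis.\<close>

lemma V_vertex_loss:
  assumes "S \<subseteq> U" "\<And>f. f \<in> S \<Longrightarrow> live t f \<Longrightarrow> p f \<le> P" "0 \<le> P" "P \<le> 1" "0 < t b"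
  shows "V S t \<le> P + P * V S (exhaust {b} t) + (1 - P) * V S (spend {b} t)"
  using assms
proof (induction "card S" arbitrary: S t rule: less_induct)
  case less
  note prems = less.prems
  have fin: "finite S" using less.prems finite_U finite_subset by blast
  show ?case
  proof (rule V_le)
    fix f assume f: "f \<in> S" "live t f"
    let ?q = "p f"
    have c: "card (S - {f}) < card S" using fin f(1) by (rule card_Diff1_less)
    have sub: "S - {f} \<subseteq> U" using prems by auto
    have q: "0 \<le> ?q" "?q \<le> P" "?q \<le> 1"
      using f prems p_nonneg p_le_1 by auto
    have IH: "V (S - {f}) t' \<le> P + P * V (S - {f}) (exhaust {b} t') + (1 - P) * V (S - {f}) (spend {b} t')"
      if "t' \<le> t" "0 < t' b" for t'
      by (rule less.hyps[OF c sub]) (use prems live_mono[OF that(1)] that(2) in auto)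
    show "probe_value S t f \<le> P + P * V S (exhaust {b} t) + (1 - P) * V S (spend {b} t)"
    proof (cases "b \<in> f")
      case False
      have 1: "V (S - {f}) (exhaust f t) \<le> P + P * V (S - {f}) (exhaust f (exhaust {b} t)) + (1 - P) * V (S - {f}) (exhaust f (spend {b} t))"
        using IH[OF exhaust_le, of f] False prems(5)
        by (simp add: exhaust_def[of f t b] exhaust_commute[of f "{b}"] exhaust_spend_commute[of f "{b}"])
      have 2: "V (S - {f}) (spend f t) \<le> P + P * V (S - {f}) (spend f (exhaust {b} t)) + (1 - P) * V (S - {f}) (spend f (spend {b} t))"
        using IH[OF spend_le, of f] False prems(5)
        by (simp add: spend_def[of f t b] spend_commute[of f "{b}"] exhaust_spend_commute[of "{b}" f])
      have 3: "probe_value S (exhaust {b} t) f \<le> V S (exhaust {b} t)"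
        using prems f False by (intro probe_value_le_V) (auto simp: exhaust_def)
      have 4: "probe_value S (spend {b} t) f \<le> V S (spend {b} t)"
        using prems f False by (intro probe_value_le_V) (auto simp: spend_def)
      have "probe_value S t f \<le> P + P * probe_value S (exhaust {b} t) f + (1 - P) * probe_value S (spend {b} t) f"
        using probe_value_mono[OF _ 1 2] f prems(1)
        unfolding probe_value_def[of S "exhaust {b} t"] probe_value_def[of S "spend {b} t"]
        by (auto simp: algebra_simps)
      also have "\<dots> \<le> P + P * V S (exhaust {b} t) + (1 - P) * V S (spend {b} t)"
        using 3 4 prems by (intro add_mono mult_left_mono) auto
      finally show ?thesis .
    next
      case True
      let ?s = "V (S - {f}) (exhaust f t)"
      let ?y = "V (S - {f}) (exhaust {b} (spend f t))"
      let ?x = "V S (exhaust {b} t)"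
      have sy: "?s \<le> ?y"
        using sub True by (intro V_mono) (auto simp: le_fun_def exhaust_def spend_def)
      have yx: "?y \<le> ?x"
        using prems by (intro V_mono) (auto simp: exhaust_mono spend_le)
      \<comment> \<open>Once \<open>b\<close> is exhausted \<open>f\<close> is out of reach, so both
        of its branches lie below the state that has merely lost \<open>b\<close>.\<close>
      have mix: "?q * ?s + (1 - ?q) * ?y \<le> ?x"
        using sy yx q mult_left_mono[of ?s ?x ?q] mult_left_mono[of ?y ?x "1 - ?q"]
        by (simp add: algebra_simps)
      show ?thesis
      \<comment> \<open>With one unit left, the two outcomes of the fictitious probe coincide and
        the gain of \<open>f\<close> is paid for by \<open>?q \<le> P\<close>.\<close>
      proof (cases "t b = 1")
        case one: True
        have e: "spend {b} t = exhaust {b} t" "exhaust {b} (spend f t) = spend f t"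
          using one True by (auto simp: fun_eq_iff spend_def exhaust_def)
        show ?thesis unfolding probe_value_def using mix q e by (simp add: algebra_simps)
      next
        case False
        then have t2: "1 < t b" using prems by auto
        let ?z = "V (S - {f}) (spend f (spend {b} t))"
        have 1: "V (S - {f}) (spend f t) \<le> P + P * ?y + (1 - P) * ?z"
          using IH[OF spend_le, of f] True t2 by (simp add: spend_def[of f t b] spend_commute[of f "{b}"])
        have e: "exhaust f (spend {b} t) = exhaust f t" using True by (intro exhaust_spend_subset) auto
        have "probe_value S (spend {b} t) f \<le> V S (spend {b} t)"
          using prems f t2 by (intro probe_value_le_V) (auto simp: spend_def)
        then have 2: "?q * (1 + ?s) + (1 - ?q) * ?z \<le> V S (spend {b} t)"
          unfolding probe_value_def e .
        have "probe_value S t f \<le> ?q * (1 + ?s) + (1 - ?q) * (P + P * ?y + (1 - P) * ?z)"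
          by (rule probe_value_mono) (use 1 f prems in auto)
        \<comment> \<open>An exact regrouping: the constant terms match because
          \<open>?q + (1 - ?q) * P = P + (1 - P) * ?q\<close>.\<close>
        also have "\<dots> = P + P * (?q * ?s + (1 - ?q) * ?y) + (1 - P) * (?q * (1 + ?s) + (1 - ?q) * ?z)"
          by (simp add: algebra_simps)
        also have "\<dots> \<le> P + P * ?x + (1 - P) * V S (spend {b} t)"
          using mix 2 prems by (intro add_mono mult_left_mono) auto
        finally show ?thesis .
      qed
    qed
  qed (use prems V_nonneg in \<open>auto intro!: add_nonneg_nonneg\<close>)
qed

text \<open>The 2 stands for one \<open>p e\<close> per endpoint. A first probe disjoint from
  \<open>e\<close> commutes with it. A first probe meeting \<open>e\<close> in one vertex
  \<open>a\<close> leaves the other endpoint \<open>b\<close>, whose separate loss is bounded by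
  \<open>V_vertex_loss\<close>.\<close>

lemma V_edge_loss:
  assumes "S \<subseteq> U" "e \<in> S" "live t e" "\<And>f. f \<in> S \<Longrightarrow> live t f \<Longrightarrow> p f \<le> p e"
  shows "V S t \<le> 2 * p e + p e * V (S - {e}) (exhaust e t) + (1 - p e) * V (S - {e}) (spend e t)"
  using assms
proof (induction "card S" arbitrary: S t rule: less_induct)
  case less
  note prems = less.prems
  let ?P = "p e"
  have fin: "finite S" using less.prems finite_U finite_subset by blast
  have P: "0 \<le> ?P" "?P \<le> 1" using prems p_nonneg p_le_1 by auto
  have sub': "S - {e} \<subseteq> U" using prems by auto
  show ?case
  proof (rule V_le)
    fix f assume f: "f \<in> S" "live t f"
    let ?q = "p f"
    let ?E = "S - {f} - {e}"
    have c: "card (S - {f}) < card S" using fin f(1) by (rule card_Diff1_less)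
    have sub: "S - {f} \<subseteq> U" using prems by auto
    have q: "0 \<le> ?q" "?q \<le> ?P" "?q \<le> 1"
      using f prems p_nonneg p_le_1 by auto
    have swap: "S - {e} - {f} = ?E" by auto
    have pmax: "p g \<le> ?P" if "t' \<le> t" "g \<in> S" "live t' g" for t' g
      using prems(4)[OF that(2)] live_mono[OF that(1)] that(3) by blast
    have IH: "V (S - {f}) t' \<le> 2 * ?P + ?P * V ?E (exhaust e t') + (1 - ?P) * V ?E (spend e t')"
      if "t' \<le> t" "live t' e" "f \<noteq> e" for t'
      by (rule less.hyps[OF c sub]) (use that prems pmax in auto)
    show "probe_value S t f \<le> 2 * ?P + ?P * V (S - {e}) (exhaust e t) + (1 - ?P) * V (S - {e}) (spend e t)"
    proof (cases "f = e")
      case True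
      then show ?thesis using P by (simp add: probe_value_def algebra_simps)
    next
      case ne: False
      show ?thesis
      proof (cases "f \<inter> e = {}")
        case True
        then have d: "e \<inter> f = {}" by auto
        have 1: "V (S - {f}) (exhaust f t) \<le> 2 * ?P + ?P * V ?E (exhaust f (exhaust e t)) + (1 - ?P) * V ?E (exhaust f (spend e t))"
          unfolding exhaust_commute[of f e] exhaust_spend_commute[OF True]
          by (rule IH[OF exhaust_le _ ne]) (use d prems(3) in \<open>auto simp: exhaust_def\<close>)
        have 2: "V (S - {f}) (spend f t) \<le> 2 * ?P + ?P * V ?E (spend f (exhaust e t)) + (1 - ?P) * V ?E (spend f (spend e t))"
          unfolding spend_commute[of f e] exhaust_spend_commute[OF d, symmetric]
          by (rule IH[OF spend_le _ ne]) (use d prems(3) in \<open>auto simp: spend_def\<close>)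
        have 3: "probe_value (S - {e}) (exhaust e t) f \<le> V (S - {e}) (exhaust e t)"
          using prems f ne d by (intro probe_value_le_V) (auto simp: exhaust_def)
        have 4: "probe_value (S - {e}) (spend e t) f \<le> V (S - {e}) (spend e t)"
          using prems f ne d by (intro probe_value_le_V) (auto simp: spend_def)
        have "probe_value S t f \<le> 2 * ?P + ?P * probe_value (S - {e}) (exhaust e t) f
            + (1 - ?P) * probe_value (S - {e}) (spend e t) f"
          using probe_value_mono[OF _ 1 2] f prems(1)
          unfolding probe_value_def[of "S - {e}" "exhaust e t"] probe_value_def[of "S - {e}" "spend e t"] swap
          by (auto simp: algebra_simps)
        also have "\<dots> \<le> 2 * ?P + ?P * V (S - {e}) (exhaust e t) + (1 - ?P) * V (S - {e}) (spend e t)"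
          using 3 4 P by (intro add_mono mult_left_mono) auto
        finally show ?thesis .
      next
        case False
        have c2: "card e = 2" "card f = 2" using f prems card_U by auto
        \<comment> \<open>Distinct edges with two vertices each that meet share exactly one vertex,
          here \<open>a\<close>.\<close>
        obtain a b where ab: "e = {a, b}" "a \<noteq> b" "a \<in> f" "b \<notin> f"
        proof -
          obtain x y where xy: "e = {x, y}" "x \<noteq> y" using c2 by (auto simp: card_2_iff)
          have "\<not> (x \<in> f \<and> y \<in> f)"
          proof
            assume "x \<in> f \<and> y \<in> f"
            then have "e \<subseteq> f" using xy by auto
            moreover have "finite f" using c2 by (metis card.infinite zero_neq_numeral)
            ultimately have "e = f" using c2 by (metis card_subset_eq)
            then show False using ne by simp
          qed
          then show ?thesis using that[of x y] that[of y x] xy False by auto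
        qed
        have tab: "0 < t a" "0 < t b" using prems ab by auto
        let ?s = "V ?E (exhaust f (exhaust e t))"
        let ?y = "V ?E (exhaust e (spend f t))"
        let ?x = "V (S - {e}) (exhaust e t)"
        have sy: "?s \<le> ?y"
          using sub by (intro V_mono) (auto simp: le_fun_def exhaust_def spend_def)
        have yx: "?y \<le> ?x"
          using prems by (intro V_mono) (auto simp: exhaust_mono spend_le)
        have mix: "?q * ?s + (1 - ?q) * ?y \<le> ?x"
          using sy yx q mult_left_mono[of ?s ?x ?q] mult_left_mono[of ?y ?x "1 - ?q"]
          by (simp add: algebra_simps)
        have bb: "exhaust {b} (exhaust f t) = exhaust f (exhaust e t)"
            "spend {b} (exhaust f t) = exhaust f (spend e t)"
          using ab by (auto simp: fun_eq_iff exhaust_def spend_def)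
        show ?thesis
        proof (cases "t a = 1")
          case True
          \<comment> \<open>Either outcome of \<open>f\<close> uses up \<open>a\<close>, which makes
            \<open>e\<close> dead. What is lost is \<open>?q\<close> for \<open>f\<close> and
            \<open>?P\<close> at \<open>b\<close>, and \<open>?q \<le> ?P\<close> gives
            \<open>2 * ?P\<close>.\<close>
          let ?t = "exhaust {a} t"
          have "probe_value S t f \<le> ?q * (1 + V S ?t) + (1 - ?q) * V S ?t"
            using prems f ab True
            by (intro probe_value_mono V_mono) (auto simp: le_fun_def exhaust_def spend_def)
          also have "\<dots> = ?q + V S ?t" by (simp add: algebra_simps)
          also have "V S ?t \<le> V (S - {e}) ?t"
            using prems ab by (intro V_remove_dead) (auto simp: exhaust_def)
          also have "\<dots> \<le> ?P + ?P * V (S - {e}) (exhaust {b} ?t) + (1 - ?P) * V (S - {e}) (spend {b} ?t)"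
          proof (rule V_vertex_loss[OF sub' _ P])
            show "p g \<le> ?P" if "g \<in> S - {e}" "live ?t g" for g
              using pmax[of ?t g] that exhaust_le[of "{a}" t] by auto
          qed (use ab tab in \<open>auto simp: exhaust_def\<close>)
          also have "exhaust {b} ?t = exhaust e t"
            using ab by (auto simp: fun_eq_iff exhaust_def)
          also have "spend {b} ?t = spend e t"
            using ab True by (auto simp: fun_eq_iff exhaust_def spend_def)
          finally show ?thesis using q by (simp add: algebra_simps)
        next
          case False
          then have t2: "1 < t a" using tab by auto
          \<comment> \<open>If \<open>f\<close> is present, \<open>a\<close> is gone and only the
            loss at \<open>b\<close> remains. If \<open>f\<close> is absent, \<open>e\<close> is
            still live and the induction hypothesis applies.\<close>
          let ?u = "V ?E (exhaust f (spend e t))"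
          let ?z = "V ?E (spend f (spend e t))"
          have "V (S - {f}) (exhaust f t) \<le> V ?E (exhaust f t)"
            using sub ab by (intro V_remove_dead) (auto simp: exhaust_def)
          also have "\<dots> \<le> ?P + ?P * V ?E (exhaust {b} (exhaust f t)) + (1 - ?P) * V ?E (spend {b} (exhaust f t))"
          proof (rule V_vertex_loss[OF _ _ P])
            show "p g \<le> ?P" if "g \<in> ?E" "live (exhaust f t) g" for g
              using pmax[of "exhaust f t" g] that exhaust_le[of f t] by auto
          qed (use sub ab tab in \<open>auto simp: exhaust_def\<close>)
          finally have 1: "V (S - {f}) (exhaust f t) \<le> ?P + ?P * ?s + (1 - ?P) * ?u"
            unfolding bb .
          have "live (spend f t) e"
            using ab tab t2 by (auto simp: spend_def)
          from IH[OF spend_le this ne]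
          have 2: "V (S - {f}) (spend f t) \<le> 2 * ?P + ?P * ?y + (1 - ?P) * ?z"
            by (simp add: spend_commute[of e f])
          have "live (spend e t) f"
            using f(2) ab t2 by (auto simp: spend_def)
          then have "probe_value (S - {e}) (spend e t) f \<le> V (S - {e}) (spend e t)"
            using prems f ne by (intro probe_value_le_V) auto
          then have 3: "?q * (1 + ?u) + (1 - ?q) * ?z \<le> V (S - {e}) (spend e t)"
            unfolding probe_value_def swap .
          have "probe_value S t f \<le> ?q * (1 + (?P + ?P * ?s + (1 - ?P) * ?u)) + (1 - ?q) * (2 * ?P + ?P * ?y + (1 - ?P) * ?z)"
            by (rule probe_value_mono) (use 1 2 f prems in auto)
          \<comment> \<open>Exact again:
            \<open>?q * (1 + ?P) + (1 - ?q) * (2 * ?P) = 2 * ?P + (1 - ?P) * ?q\<close>.\<close>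
          also have "\<dots> = 2 * ?P + ?P * (?q * ?s + (1 - ?q) * ?y) + (1 - ?P) * (?q * (1 + ?u) + (1 - ?q) * ?z)"
            by (simp add: algebra_simps)
          also have "\<dots> \<le> 2 * ?P + ?P * ?x + (1 - ?P) * V (S - {e}) (spend e t)"
            using mix 3 P by (intro add_mono mult_left_mono) auto
          finally show ?thesis .
        qed
      qed
    qed
  qed (use prems P V_nonneg[OF sub'] in \<open>auto intro!: add_nonneg_nonneg\<close>)
qed

end

section \<open>The value of the greedy strategy\<close>

definition unprobed :: "'v sm_instance \<Rightarrow> 'v history \<Rightarrow> 'v set set" where
  "unprobed I h = edges I - fst ` set h"

definition residual :: "'v sm_instance \<Rightarrow> 'v history \<Rightarrow> 'v \<Rightarrow> nat" where
  "residual I h v = (if v \<in> \<Union>(matching h) then 0 else patience I v - failed_probes h v)"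

lemma probeable_iff: "probeable I h e \<longleftrightarrow> e \<in> unprobed I h \<and> live (residual I h) e"
  by (auto simp: probeable_def unprobed_def residual_def)

lemma unprobed_snoc: "unprobed I (h @ [(e, b)]) = unprobed I h - {e}"
  by (auto simp: unprobed_def)

lemma matching_snoc: "matching (h @ [(e, b)]) = (if b then insert e (matching h) else matching h)"
  by (auto simp: matching_def)

lemma residual_snoc:
  "residual I (h @ [(e, b)]) = (if b then exhaust e (residual I h) else spend e (residual I h))"
  by (auto simp: fun_eq_iff residual_def exhaust_def spend_def matching_snoc failed_probes_def)

lemma finite_matching: "finite (matching h)"
  by (rule finite_subset[of _ "fst ` set h"]) (force simp: matching_def)+

lemma matching_subset: "matching h \<subseteq> fst ` set h"
  by (force simp: matching_def)

text \<open>The probability tree of a strategy, cut off after \<open>k\<close> steps so that the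
  recursion is structural for any strategy whatsoever.\<close>

fun gain :: "'v sm_instance \<Rightarrow> 'v strategy \<Rightarrow> nat \<Rightarrow> 'v history \<Rightarrow> real" where
  "gain I \<sigma> 0 h = 0"
| "gain I \<sigma> (Suc k) h = (case \<sigma> h of None \<Rightarrow> 0 | Some e \<Rightarrow>
     prob I e * (1 + gain I \<sigma> k (h @ [(e, True)])) + (1 - prob I e) * gain I \<sigma> k (h @ [(e, False)]))"

context
  fixes I :: "'v sm_instance"
  assumes wf: "sm_wf I"
begin

lemma finite_edges: "finite (edges I)"
  using wf by (auto simp: sm_wf_def intro: finite_subset[of _ "Pow (verts I)"])

interpretation weighted_edges "edges I" "prob I"
  using wf finite_edges by unfold_locales (auto simp: sm_wf_def)

lemma unprobed_subset: "unprobed I h \<subseteq> edges I"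
  by (auto simp: unprobed_def)

text \<open>A strategy may look at the whole history, but its legal probes and their effects depend
  on the state alone, so the maximum over first probes dominates it at every step.\<close>

lemma gain_le_opt:
  assumes "valid_strategy I \<tau>" "legal I h"
  shows "gain I \<tau> k h \<le> V (unprobed I h) (residual I h)"
  using assms(2)
proof (induction k arbitrary: h)
  case (Suc k)
  show ?case
  proof (cases "\<tau> h")
    case (Some e)
    have e: "probeable I h e" using Some assms(1) Suc.prems by (auto simp: valid_strategy_def)
    then have eE: "e \<in> edges I" by (simp add: probeable_def)
    have "gain I \<tau> k (h @ [(e, b)]) \<le> V (unprobed I h - {e}) (if b then exhaust e (residual I h) else spend e (residual I h))" for b
      using Suc.IH[OF legal_snoc[OF Suc.prems e, of b]] by (simp add: unprobed_snoc residual_snoc)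
    from this[of True] this[of False]
    have "gain I \<tau> (Suc k) h \<le> probe_value (unprobed I h) (residual I h) e"
      unfolding probe_value_def using Some p_nonneg[OF eE] p_le_1[OF eE]
      by (auto intro!: add_mono mult_left_mono)
    also have "\<dots> \<le> V (unprobed I h) (residual I h)"
      using e unprobed_subset by (intro probe_value_le_V) (auto simp: probeable_iff)
    finally show ?thesis .
  qed (simp add: V_nonneg unprobed_subset)
qed (simp add: V_nonneg unprobed_subset)

text \<open>Ties are left open and only legal histories are constrained, so that any strategy read
  off from the program's outputs can qualify.\<close>

definition greedy :: "'v strategy \<Rightarrow> bool" where
  "greedy \<sigma> \<longleftrightarrow> (\<forall>h. legal I h \<longrightarrow> (case \<sigma> h of None \<Rightarrow> \<forall>e. \<not> probeable I h e
     | Some e \<Rightarrow> probeable I h e \<and> (\<forall>f. probeable I h f \<longrightarrow> prob I f \<le> prob I e)))"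

lemma greedy_valid: "greedy \<sigma> \<Longrightarrow> valid_strategy I \<sigma>"
  by (auto simp: greedy_def valid_strategy_def split: option.splits)

text \<open>Where \<open>V_edge_loss\<close> concedes \<open>2 * prob I e\<close>, greedy earns
  \<open>prob I e\<close>; with the doubled gains from the induction hypothesis this adds up to
  twice the greedy gain. The budget \<open>k\<close> covers all unprobed edges, so greedy is not cut
  short.\<close>

lemma opt_le_greedy_gain:
  assumes "greedy \<sigma>" "legal I h" "card (unprobed I h) \<le> k"
  shows "V (unprobed I h) (residual I h) \<le> 2 * gain I \<sigma> k h"
  using assms(2,3)
proof (induction k arbitrary: h)
  case 0
  then have "unprobed I h = {}"
    using finite_subset[OF unprobed_subset finite_edges] by auto
  then show ?case by (simp add: V_eq)
next
  case (Suc k)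
  let ?S = "unprobed I h" and ?t = "residual I h"
  show ?case
  proof (cases "\<sigma> h")
    case None
    then have "\<not> probeable I h e" for e
      using assms(1) Suc.prems by (auto simp: greedy_def split: option.splits)
    then have "V ?S ?t \<le> 0"
      by (intro V_le unprobed_subset) (unfold probeable_iff, blast+)
    then show ?thesis using None by simp
  next
    case (Some e)
    then have g: "probeable I h e \<and> (\<forall>f. probeable I h f \<longrightarrow> prob I f \<le> prob I e)"
      using assms(1) Suc.prems by (force simp: greedy_def)
    then have e: "e \<in> ?S" "live ?t e" "probeable I h e"
      and max: "\<And>f. f \<in> ?S \<Longrightarrow> live ?t f \<Longrightarrow> prob I f \<le> prob I e"
      unfolding probeable_iff by blast+
    then have eE: "e \<in> edges I" using unprobed_subset by auto
    have "card (?S - {e}) < card ?S"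
      using finite_subset[OF unprobed_subset finite_edges] e(1) by (rule card_Diff1_less)
    then have "V (?S - {e}) (if b then exhaust e ?t else spend e ?t) \<le> 2 * gain I \<sigma> k (h @ [(e, b)])" for b
      using Suc.IH[OF legal_snoc[OF Suc.prems(1) e(3), of b]] Suc.prems(2)
      unfolding unprobed_snoc residual_snoc by linarith
    from this[of True] this[of False]
    have "2 * prob I e + prob I e * V (?S - {e}) (exhaust e ?t) + (1 - prob I e) * V (?S - {e}) (spend e ?t)
        \<le> 2 * prob I e + prob I e * (2 * gain I \<sigma> k (h @ [(e, True)])) + (1 - prob I e) * (2 * gain I \<sigma> k (h @ [(e, False)]))"
      using p_nonneg[OF eE] p_le_1[OF eE] by (intro add_mono mult_left_mono) auto
    also have "\<dots> = 2 * gain I \<sigma> (Suc k) h"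
      using Some by (simp add: algebra_simps)
    finally show ?thesis
      using V_edge_loss[OF unprobed_subset e(1,2) max] by linarith
  qed
qed

text \<open>All later probes are of edges unprobed so far, so no other outcome is ever read. This
  erases the update at the edge just probed in the proof of \<open>expected_run\<close>.\<close>

lemma run_cong:
  assumes "valid_strategy I \<sigma>" "legal I h" "\<And>e. e \<in> unprobed I h \<Longrightarrow> \<omega> e = \<omega>' e"
  shows "(probe_step \<sigma> \<omega> ^^ k) h = (probe_step \<sigma> \<omega>' ^^ k) h"
  using assms(2,3)
proof (induction k arbitrary: h)
  case (Suc k)
  show ?case
  proof (cases "\<sigma> h")
    case None
    then show ?thesis using Suc by (simp add: funpow_Suc_right probe_step_def del: funpow.simps)
  next
    case (Some e)
    have e: "probeable I h e" using Some assms(1) Suc.prems by (auto simp: valid_strategy_def)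
    have "\<omega> e = \<omega>' e" using Suc.prems(2) e by (simp add: probeable_iff)
    then show ?thesis
      using Some Suc.IH[OF legal_snoc[OF Suc.prems(1) e, of "\<omega>' e"]] Suc.prems(2)
      by (simp add: funpow_Suc_right probe_step_def unprobed_snoc del: funpow.simps)
  qed
qed simp

text \<open>Deferred decisions: given \<open>h\<close>, only the outcomes of unprobed edges are
  still random. The product distribution is split at the next probed edge, and the remaining
  coordinates form the distribution of the induction hypothesis.\<close>

lemma expected_run:
  assumes "valid_strategy I \<sigma>" "legal I h"
  shows "measure_pmf.expectation (Pi_pmf (unprobed I h) False (\<lambda>e. bernoulli_pmf (prob I e)))
     (\<lambda>\<omega>. real (card (matching ((probe_step \<sigma> \<omega> ^^ k) h)))) = real (card (matching h)) + gain I \<sigma> k h"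
  using assms(2)
proof (induction k arbitrary: h)
  case (Suc k)
  show ?case
  proof (cases "\<sigma> h")
    case None
    have "(probe_step \<sigma> \<omega> ^^ j) h = h" for \<omega> j
      by (induction j) (auto simp: probe_step_def None)
    then show ?thesis using None by (simp del: funpow.simps)
  next
    case (Some e)
    let ?A = "unprobed I h - {e}"
    let ?ber = "\<lambda>e. bernoulli_pmf (prob I e)"
    let ?D = "Pi_pmf ?A False ?ber"
    let ?r = "\<lambda>j \<omega> h. real (card (matching ((probe_step \<sigma> \<omega> ^^ j) h)))"
    have e: "probeable I h e" using Some assms(1) Suc.prems by (auto simp: valid_strategy_def)
    then have eU: "e \<in> unprobed I h" and eE: "e \<in> edges I" unfolding probeable_iff using unprobed_subset by auto
    have fin: "finite ?A" using finite_subset[OF unprobed_subset finite_edges] by auto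
    have leg: "legal I (h @ [(e, b)])" for b using Suc.prems e by (rule legal_snoc)
    have step: "?r (Suc k) (f(e := b)) h = ?r k f (h @ [(e, b)])" for f b
    proof -
      have "(probe_step \<sigma> (f(e := b)) ^^ Suc k) h = (probe_step \<sigma> (f(e := b)) ^^ k) (h @ [(e, b)])"
        using Some by (simp add: funpow_Suc_right probe_step_def del: funpow.simps)
      also have "\<dots> = (probe_step \<sigma> f ^^ k) (h @ [(e, b)])"
        by (rule run_cong[OF assms(1) leg]) (auto simp: unprobed_snoc)
      finally show ?thesis by simp
    qed
    have E: "measure_pmf.expectation ?D (\<lambda>f. ?r k f (h @ [(e, b)]))
        = card (matching (h @ [(e, b)])) + gain I \<sigma> k (h @ [(e, b)])" for b
      using Suc.IH[OF leg, of b] by (simp add: unprobed_snoc)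
    have fs: "finite (set_pmf ?D)"
      unfolding set_Pi_pmf[OF fin] by (rule finite_PiE_dflt) (use fin in auto)
    have "unprobed I h = insert e ?A" using eU by auto
    then have "Pi_pmf (unprobed I h) False ?ber = Pi_pmf (insert e ?A) False ?ber"
      by simp
    also have "\<dots> = map_pmf (\<lambda>(y, f). f(e := y)) (pair_pmf (?ber e) ?D)"
      by (rule Pi_pmf_insert) (use fin in auto)
    also have "\<dots> = ?ber e \<bind> (\<lambda>b. map_pmf (\<lambda>f. f(e := b)) ?D)"
      by (simp add: pair_pmf_def map_bind_pmf map_pmf_def[symmetric] bind_return_pmf map_pmf_comp)
    finally have D: "Pi_pmf (unprobed I h) False ?ber = \<dots>" .
    have "measure_pmf.expectation (Pi_pmf (unprobed I h) False ?ber) (\<lambda>\<omega>. ?r (Suc k) \<omega> h)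
      = (\<Sum>b\<in>UNIV. pmf (?ber e) b *\<^sub>R measure_pmf.expectation (map_pmf (\<lambda>f. f(e := b)) ?D) (\<lambda>\<omega>. ?r (Suc k) \<omega> h))"
      unfolding D by (rule pmf_expectation_bind) (use fs in auto)
    also have "\<dots> = (\<Sum>b\<in>UNIV. pmf (?ber e) b * (card (matching (h @ [(e, b)])) + gain I \<sigma> k (h @ [(e, b)])))"
      by (simp only: integral_map_pmf step E real_scaleR_def)
    also have "\<dots> = card (matching h) + gain I \<sigma> (Suc k) h"
    proof -
      have "e \<notin> matching h"
        using eU matching_subset by (auto simp: unprobed_def)
      then show ?thesis
        using Some p_nonneg[OF eE] p_le_1[OF eE]
        by (simp add: UNIV_bool matching_snoc finite_matching algebra_simps)
    qed
    finally show ?thesis .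
  qed
qed simp

lemma strategy_value_eq_gain:
  assumes "valid_strategy I \<sigma>"
  shows "strategy_value I \<sigma> = gain I \<sigma> (card (edges I)) []"
  using expected_run[OF assms legal_Nil, of "card (edges I)"]
  by (simp add: strategy_value_def realization_def run_strategy_def unprobed_def matching_def)

theorem greedy_two_approximation:
  assumes "greedy \<sigma>" "valid_strategy I \<tau>"
  shows "strategy_value I \<tau> \<le> 2 * strategy_value I \<sigma>"
proof -
  have "card (unprobed I []) \<le> card (edges I)"
    by (simp add: unprobed_def)
  then show ?thesis
    using gain_le_opt[OF assms(2) legal_Nil, of "card (edges I)"]
      opt_le_greedy_gain[OF assms(1) legal_Nil, of "card (edges I)"]
      strategy_value_eq_gain[OF assms(2)] strategy_value_eq_gain[OF greedy_valid[OF assms(1)]]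
    by linarith
qed

end

lemma strategy_value_nonneg: "0 \<le> strategy_value I \<sigma>"
  by (simp add: strategy_value_def)

section \<open>Cost of loop-free code and of counting loops\<close>

lemma bit_length_le: "0 < L \<Longrightarrow> x < 2 ^ L \<Longrightarrow> bit_length x \<le> L"
  by (simp add: bit_length_def floorlog_le_iff)

lemma less_power_bit_length: "x < 2 ^ bit_length x"
proof -
  have "floorlog 2 x \<le> bit_length x" by (simp add: bit_length_def)
  then show ?thesis by (simp add: floorlog_le_iff)
qed

fun loop_free :: "com \<Rightarrow> bool" where
  "loop_free Skip = True"
| "loop_free (Assign d f x y) = True"
| "loop_free (Seq c1 c2) = (loop_free c1 \<and> loop_free c2)"
| "loop_free (Cond x c1 c2) = (loop_free c1 \<and> loop_free c2)"
| "loop_free (While x c) = False"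

text \<open>32 is \<open>2 ^ 5\<close>: every constant and register number in the program fits into
  5 bits, which is why bit bounds are assumed to be at least 5.\<close>

fun small_operand :: "operand \<Rightarrow> bool" where
  "small_operand (Const k) = (k < 32)"
| "small_operand (Reg i) = (i < 32)"
| "small_operand (Mem i) = (i < 32)"

fun small_dest :: "dest \<Rightarrow> bool" where
  "small_dest (ToReg i) = (i < 32)"
| "small_dest (ToMem i) = (i < 32)"

fun small :: "com \<Rightarrow> bool" where
  "small Skip = True"
| "small (Assign d f x y) = (small_dest d \<and> small_operand x \<and> small_operand y)"
| "small (Seq c1 c2) = (small c1 \<and> small c2)"
| "small (Cond x c1 c2) = (small_operand x \<and> small c1 \<and> small c2)"
| "small (While x c) = (small_operand x \<and> small c)"

text \<open>The value for \<open>While\<close> is a dummy; \<open>exec_eval\<close> speaks of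
  loop-free code.\<close>

fun eval :: "com \<Rightarrow> ram \<Rightarrow> ram" where
  "eval Skip s = s"
| "eval (Assign d f x y) s = store s d (arith_val f (operand_val s x) (operand_val s y))"
| "eval (Seq c1 c2) s = eval c2 (eval c1 s)"
| "eval (Cond x c1 c2) s = (if operand_val s x \<noteq> 0 then eval c1 s else eval c2 s)"
| "eval (While x c) s = s"

text \<open>
  Loop-free code multiplies bit lengths by at most a constant, since each assignment at most doubles
  them; its cost is therefore linear in the bit length of the state it starts from.
\<close>

fun growth :: "com \<Rightarrow> nat" where
  "growth (Assign d f x y) = 2"
| "growth (Seq c1 c2) = growth c1 * growth c2"
| "growth (Cond x c1 c2) = growth c1 * growth c2"
| "growth _ = 1"

text \<open>In multiples of the bit bound, an operand costs at most 3 and a destination at most 2,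
  hence 8 for an assignment. In a sequence the second part starts from the bound enlarged by
  \<open>growth c1\<close>.\<close>

fun cost_factor :: "com \<Rightarrow> nat" where
  "cost_factor (Assign d f x y) = 8"
| "cost_factor (Seq c1 c2) = cost_factor c1 + cost_factor c2 * growth c1"
| "cost_factor (Cond x c1 c2) = 3 + cost_factor c1 + cost_factor c2"
| "cost_factor _ = 1"

definition bits_below :: "nat \<Rightarrow> ram \<Rightarrow> bool" where
  "bits_below L s \<longleftrightarrow> (\<forall>i. fst s i < 2 ^ L \<and> snd s i < 2 ^ L)"

lemma growth_pos: "0 < growth c"
  by (induction c rule: growth.induct) auto

lemma bits_below_mono:
  assumes "bits_below L s" "L \<le> L'"
  shows "bits_below L' s"
proof -
  have "(2::nat) ^ L \<le> 2 ^ L'" using assms(2) by simp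
  then show ?thesis using assms(1) unfolding bits_below_def by (meson less_le_trans)
qed

lemma less_32_power: "5 \<le> L \<Longrightarrow> i < 32 \<Longrightarrow> i < (2::nat) ^ L"
  using power_increasing[of 5 L "2::nat"] by simp

lemma small_operand_cost:
  assumes "small_operand x" "5 \<le> L" "bits_below L s"
  shows "operand_cost s x \<le> 3 * L" "operand_val s x < 2 ^ L"
proof -
  obtain r m where s: "s = (r, m)" by (cases s)
  have b: "bit_length (r i) \<le> L" "bit_length (m i) \<le> L" "r i < 2 ^ L" "m i < 2 ^ L" for i
    using assms(2,3) by (auto simp: bits_below_def s intro!: bit_length_le)
  have i: "bit_length k \<le> L" "k < 2 ^ L" if "k < 32" for k
    using that assms(2) by (auto intro!: bit_length_le less_32_power)
  show "operand_cost s x \<le> 3 * L" "operand_val s x < 2 ^ L"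
    unfolding s atomize_conj
  proof (cases x)
    case (Const k)
    then show "operand_cost (r, m) x \<le> 3 * L \<and> operand_val (r, m) x < 2 ^ L"
      using assms(1) i[of k] by simp
  next
    case (Reg k)
    then show "operand_cost (r, m) x \<le> 3 * L \<and> operand_val (r, m) x < 2 ^ L"
      using assms(1) i(1)[of k] b(1,3)[of k] by simp
  next
    case (Mem k)
    then show "operand_cost (r, m) x \<le> 3 * L \<and> operand_val (r, m) x < 2 ^ L"
      using assms(1) i(1)[of k] b(1)[of k] b(2,4)[of "r k"] by simp
  qed
qed

lemma small_dest_cost:
  assumes "small_dest d" "5 \<le> L" "bits_below L s"
  shows "dest_cost s d \<le> 2 * L"
proof -
  obtain r m where s: "s = (r, m)" by (cases s)
  have b: "bit_length (r i) \<le> L" for i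
    using assms(2,3) by (auto simp: bits_below_def s intro!: bit_length_le)
  have i: "bit_length k \<le> L" if "k < 32" for k
    using that assms(2) by (auto intro!: bit_length_le less_32_power)
  show ?thesis
    using assms(1) b i unfolding s by (cases d) (force intro: add_mono simp: mult_2 trans_le_add1)+
qed

lemma arith_val_less:
  assumes "x < 2 ^ L" "y < 2 ^ L" "0 < L"
  shows "arith_val f x y < 2 ^ (2 * L)"
proof -
  have "(2::nat) * 2 ^ L \<le> 2 ^ L * 2 ^ L"
    using assms(3) by (intro mult_right_mono) (auto simp: self_le_power)
  then have le: "(2::nat) * 2 ^ L \<le> 2 ^ (2 * L)" by (simp add: mult_2 power_add)
  show ?thesis
  proof (cases f)
    case Mul
    have "x * y < 2 ^ L * 2 ^ L" using assms by (intro mult_strict_mono) auto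
    then show ?thesis using Mul by (simp add: mult_2 power_add)
  next
    case Div
    have "x div y \<le> x" by simp
    then have "x div y < 2 ^ (2 * L)" using le assms by linarith
    then show ?thesis using Div by simp
  qed (use le assms in auto)
qed

lemma bits_below_store: "bits_below L s \<Longrightarrow> x < 2 ^ L \<Longrightarrow> bits_below L (store s d x)"
  by (cases s; cases d) (auto simp: bits_below_def)

lemma exec_eval:
  assumes "loop_free c" "small c" "5 \<le> L" "bits_below L s"
  shows "\<exists>T. exec c s T (eval c s) \<and> T \<le> cost_factor c * L \<and> bits_below (growth c * L) (eval c s)"
  using assms
proof (induction c arbitrary: s L)
  case Skip
  then show ?case using exec_Skip[of s] by (intro exI[of _ 1]) auto
next
  case (Assign d f x y)
  let ?T = "dest_cost s d + operand_cost s x + operand_cost s y"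
  have "?T \<le> 8 * L"
    using Assign.prems small_dest_cost[of d L s] small_operand_cost[of x L s] small_operand_cost[of y L s] by simp
  moreover have "bits_below (2 * L) (eval (Assign d f x y) s)"
    unfolding eval.simps
    using Assign.prems small_operand_cost[of x L s] small_operand_cost[of y L s]
    by (intro bits_below_store arith_val_less bits_below_mono[of L s "2 * L"]) auto
  ultimately show ?case using exec_Assign[of d f x y s] by auto
next
  case (Seq c1 c2)
  obtain T1 where 1: "exec c1 s T1 (eval c1 s)" "T1 \<le> cost_factor c1 * L" "bits_below (growth c1 * L) (eval c1 s)"
    using Seq.IH(1)[of L s] Seq.prems by auto
  have "1 * L \<le> growth c1 * L" using growth_pos[of c1] by (intro mult_right_mono) auto
  then have "5 \<le> growth c1 * L" using Seq.prems(3) by linarith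
  then obtain T2 where 2: "exec c2 (eval c1 s) T2 (eval c2 (eval c1 s))"
      "T2 \<le> cost_factor c2 * (growth c1 * L)" "bits_below (growth c2 * (growth c1 * L)) (eval c2 (eval c1 s))"
    using Seq.IH(2)[of "growth c1 * L" "eval c1 s"] Seq.prems 1(3) by auto
  have "exec (Seq c1 c2) s (T1 + T2) (eval (Seq c1 c2) s)"
    using exec_Seq[OF 1(1) 2(1)] by simp
  moreover have "T1 + T2 \<le> cost_factor (Seq c1 c2) * L"
    using 1(2) 2(2) by (simp add: algebra_simps)
  moreover have "bits_below (growth (Seq c1 c2) * L) (eval (Seq c1 c2) s)"
    using 2(3) by (simp add: ac_simps)
  ultimately show ?case by blast
next
  case (Cond x c1 c2)
  have xc: "operand_cost s x \<le> 3 * L"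
    using Cond.prems small_operand_cost[of x L s] by simp
  have g: "growth c1 * L \<le> growth (Cond x c1 c2) * L" "growth c2 * L \<le> growth (Cond x c1 c2) * L"
    using growth_pos[of c1] growth_pos[of c2] by auto
  show ?case
  proof (cases "operand_val s x = 0")
    case True
    obtain T where T: "exec c2 s T (eval c2 s)" "T \<le> cost_factor c2 * L" "bits_below (growth c2 * L) (eval c2 s)"
      using Cond.IH(2)[of L s] Cond.prems by auto
    have "exec (Cond x c1 c2) s (operand_cost s x + T) (eval (Cond x c1 c2) s)"
      using exec_CondFalse[OF True T(1)] True by simp
    moreover have "operand_cost s x + T \<le> cost_factor (Cond x c1 c2) * L"
      using xc T(2) by (simp add: algebra_simps)
    moreover have "bits_below (growth (Cond x c1 c2) * L) (eval (Cond x c1 c2) s)"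
      using bits_below_mono[OF T(3) g(2)] True by simp
    ultimately show ?thesis by blast
  next
    case False
    obtain T where T: "exec c1 s T (eval c1 s)" "T \<le> cost_factor c1 * L" "bits_below (growth c1 * L) (eval c1 s)"
      using Cond.IH(1)[of L s] Cond.prems by auto
    have "exec (Cond x c1 c2) s (operand_cost s x + T) (eval (Cond x c1 c2) s)"
      using exec_CondTrue[OF False T(1)] False by simp
    moreover have "operand_cost s x + T \<le> cost_factor (Cond x c1 c2) * L"
      using xc T(2) by (simp add: algebra_simps)
    moreover have "bits_below (growth (Cond x c1 c2) * L) (eval (Cond x c1 c2) s)"
      using bits_below_mono[OF T(3) g(1)] False by simp
    ultimately show ?thesis by blast
  qed
qed simp

definition runs_within :: "com \<Rightarrow> ram \<Rightarrow> nat \<Rightarrow> (ram \<Rightarrow> bool) \<Rightarrow> bool" where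
  "runs_within c s B Q \<longleftrightarrow> (\<exists>T s'. exec c s T s' \<and> T \<le> B \<and> Q s')"

lemma runs_within_eval:
  assumes "loop_free c" "small c" "5 \<le> L" "bits_below L s" "Q (eval c s)"
  shows "runs_within c s (cost_factor c * L) Q"
  using exec_eval[OF assms(1-4)] assms(5) unfolding runs_within_def by blast

lemma runs_within_Seq:
  assumes "runs_within c1 s B1 P" "\<And>s'. P s' \<Longrightarrow> runs_within c2 s' B2 Q"
  shows "runs_within (Seq c1 c2) s (B1 + B2) Q"
  using assms unfolding runs_within_def by (meson exec_Seq add_mono)

text \<open>The index of \<open>Inv\<close> is the exact number of rounds left. One bound
  \<open>B\<close> serves all rounds, which is where an invariant with a fixed bit bound pays off;
  there are \<open>j\<close> bodies and \<open>j + 1\<close> tests.\<close>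

lemma runs_within_While:
  assumes step: "\<And>j s. Inv (Suc j) s \<Longrightarrow> operand_val s x \<noteq> 0 \<and> runs_within c s B (Inv j)"
    and stop: "\<And>s. Inv 0 s \<Longrightarrow> operand_val s x = 0"
    and test: "\<And>j s. Inv j s \<Longrightarrow> operand_cost s x \<le> B'"
  shows "Inv j s \<Longrightarrow> runs_within (While x c) s ((j + 1) * (B + B')) (Inv 0)"
proof (induction j arbitrary: s)
  case 0
  have "exec (While x c) s (operand_cost s x) s"
    by (rule exec_WhileFalse[OF stop[OF 0]])
  then show ?case using test[OF 0] 0 unfolding runs_within_def by (metis add_0 mult_1 trans_le_add2)
next
  case (Suc j)
  obtain T1 s1 where 1: "exec c s T1 s1" "T1 \<le> B" "Inv j s1" and x: "operand_val s x \<noteq> 0"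
    using step[OF Suc.prems] by (auto simp: runs_within_def)
  obtain T2 s2 where 2: "exec (While x c) s1 T2 s2" "T2 \<le> (j + 1) * (B + B')" "Inv 0 s2"
    using Suc.IH[OF 1(3)] by (auto simp: runs_within_def)
  have "exec (While x c) s (operand_cost s x + T1 + T2) s2"
    by (rule exec_WhileTrue[OF x 1(1) 2(1)])
  moreover have "operand_cost s x + T1 + T2 \<le> (Suc j + 1) * (B + B')"
    using test[OF Suc.prems] 1(2) 2(2) by simp
  ultimately show ?case using 2(3) unfolding runs_within_def by blast
qed

section \<open>The greedy program\<close>

fun block :: "com list \<Rightarrow> com" where
  "block [] = Skip"
| "block [c] = c"
| "block (c # cs) = Seq c (block cs)"

definition copy :: "nat \<Rightarrow> operand \<Rightarrow> com" where
  "copy d x = Assign (ToReg d) Add x (Const 0)"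

definition load :: "nat \<Rightarrow> nat \<Rightarrow> nat \<Rightarrow> com" where
  "load d i k = block [Assign (ToReg 18) Add (Reg i) (Const k), copy d (Mem 18)]"

text \<open>As \<open>Sub\<close> truncates at zero, the two differences sum to the absolute
  difference, which is zero iff the registers agree.\<close>

definition distance :: "nat \<Rightarrow> nat \<Rightarrow> nat \<Rightarrow> com" where
  "distance d i j = block [Assign (ToReg 18) Sub (Reg i) (Reg j),
     Assign (ToReg 19) Sub (Reg j) (Reg i), Assign (ToReg d) Add (Reg 18) (Reg 19)]"

definition charge :: "nat \<Rightarrow> nat \<Rightarrow> nat \<Rightarrow> com" where
  "charge i j t = block [distance 18 i j,
     Cond (Reg 18) Skip (Cond (Reg 17) (copy t (Const 0)) (Assign (ToReg t) Sub (Reg t) (Const 1)))]"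

section \<open>Effect of the straight-line blocks on the registers\<close>

lemma load_effect:
  assumes "\<forall>j. r j < B" "\<forall>j. m j < B" "r i + k < B"
  obtains r' where "eval (load d i k) (r, m) = (r', m)" "r' d = m (r i + k)"
    "\<forall>j. j \<noteq> d \<longrightarrow> j \<noteq> 18 \<longrightarrow> r' j = r j" "\<forall>j. r' j < B"
proof
  show "eval (load d i k) (r, m) = (r(18 := r i + k, d := m (r i + k)), m)"
    by (simp add: load_def copy_def)
qed (use assms in auto)

lemma distance_effect:
  assumes "\<forall>j. r j < B" "i \<notin> {18, 19}" "j \<notin> {18, 19}"
  obtains r' where "eval (distance d i j) (r, m) = (r', m)" "r' d = (r i - r j) + (r j - r i)"
    "\<forall>l. l \<noteq> d \<longrightarrow> l \<noteq> 18 \<longrightarrow> l \<noteq> 19 \<longrightarrow> r' l = r l" "\<forall>l. r' l < B"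
proof
  show "eval (distance d i j) (r, m)
    = (r(18 := r i - r j, 19 := r j - r i, d := (r i - r j) + (r j - r i)), m)"
    using assms by (simp add: distance_def)
  have "x - y + (y - x) < B" "x - y < B" if "x < B" "y < B" for x y :: nat
    using that by linarith+
  then show "\<forall>l. (r(18 := r i - r j, 19 := r j - r i, d := (r i - r j) + (r j - r i))) l < B"
    using assms(1) by simp
qed simp_all

lemma charge_effect:
  assumes "\<forall>j. r j < B" "i \<notin> {18, 19}" "j \<notin> {18, 19}" "t \<notin> {18, 19}"
  obtains r' where "eval (charge i j t) (r, m) = (r', m)"
    "r' t = (if r i = r j then if r 17 \<noteq> 0 then 0 else r t - 1 else r t)"
    "\<forall>l. l \<noteq> t \<longrightarrow> l \<noteq> 18 \<longrightarrow> l \<noteq> 19 \<longrightarrow> r' l = r l" "\<forall>l. r' l < B"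
proof -
  obtain r1 where r1: "eval (distance 18 i j) (r, m) = (r1, m)" "r1 18 = (r i - r j) + (r j - r i)"
      "\<forall>l. l \<noteq> 18 \<longrightarrow> l \<noteq> 19 \<longrightarrow> r1 l = r l" "\<forall>l. r1 l < B"
    using assms distance_effect[of r B i j 18 m] by metis
  let ?x = "if r i = r j then if r 17 \<noteq> 0 then 0 else r t - 1 else r t"
  show thesis
  proof (rule that)
    have "r1(t := r t) = r1" using r1(3) assms(4) by (simp add: fun_upd_idem)
    moreover have "r1 18 = 0 \<longleftrightarrow> r i = r j" using r1(2) by auto
    ultimately show "eval (charge i j t) (r, m) = (r1(t := ?x), m)"
      using assms(4) r1(1,3) by (simp add: charge_def copy_def)
    have "?x < B" using assms(1) by (auto intro: le_less_trans[OF diff_le_self])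
    with r1(4) show "\<forall>l. (r1(t := ?x)) l < B" by (metis fun_upd_apply)
  qed (use r1(3) in auto)
qed

text \<open>
  Registers 0 to 4 hold the output flag and the best edge so far as a tuple \<open>(u, v, a, b)\<close>, 5 and 6
  the number of remaining edges and the address of the current one, 7 to 10 the current edge,
  11 and 12 the residual patiences of its endpoints, 13 and 14 the number of remaining history
  entries and the address of the current one, 15 to 17 that entry, 18 and 19 scratch values, and
  20 the address of the history. An edge that has been probed before is recorded by a zero in
  register 11, so that it is probeable iff registers 11 and 12 both end up positive.
\<close>

definition scan_body :: com where
  "scan_body = block [load 15 14 0, load 16 14 1, load 17 14 2,
     charge 15 7 11, charge 16 7 11, charge 15 8 12, charge 16 8 12,
     distance 15 15 7, distance 16 16 8,
     Cond (Reg 15) Skip (Cond (Reg 16) Skip (copy 11 (Const 0))),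
     Assign (ToReg 14) Add (Reg 14) (Const 3), Assign (ToReg 13) Sub (Reg 13) (Const 1)]"

text \<open>The input begins with two lengths, so the patience of vertex \<open>v\<close> sits at
  address \<open>v + 2\<close>.\<close>

definition edge_prologue :: com where
  "edge_prologue = block [load 7 6 0, load 8 6 1, load 9 6 2, load 10 6 3,
     load 11 7 2, load 12 8 2, load 13 20 0, Assign (ToReg 14) Add (Reg 20) (Const 1)]"

text \<open>Fractions are compared by cross multiplication. A tie replaces the best edge; hence a
  probeable edge of probability 0 still displaces the initial value 0/1.\<close>

definition edge_epilogue :: com where
  "edge_epilogue = block [Assign (ToReg 18) Mul (Reg 3) (Reg 10),
     Assign (ToReg 19) Mul (Reg 9) (Reg 4), Assign (ToReg 18) Sub (Reg 18) (Reg 19),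
     Cond (Reg 11) (Cond (Reg 12) (Cond (Reg 18) Skip
       (block [copy 0 (Const 1), copy 1 (Reg 7), copy 2 (Reg 8), copy 3 (Reg 9), copy 4 (Reg 10)]))
       Skip) Skip,
     Assign (ToReg 6) Add (Reg 6) (Const 4), Assign (ToReg 5) Sub (Reg 5) (Const 1)]"

text \<open>Register 0 is still zero here and serves as base address for reading both lengths.
  Register 4 becomes the denominator of the initial best value 0/1.\<close>

definition initialize :: com where
  "initialize = block [load 6 0 0, Assign (ToReg 6) Add (Reg 6) (Const 2), load 5 0 1,
     Assign (ToReg 20) Mul (Reg 5) (Const 4), Assign (ToReg 20) Add (Reg 20) (Reg 6),
     copy 4 (Const 1)]"

definition edge_body :: com where
  "edge_body = Seq edge_prologue (Seq (While (Reg 13) scan_body) edge_epilogue)"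

definition greedy_program :: com where
  "greedy_program = Seq initialize (While (Reg 5) edge_body)"

lemmas program_defs = scan_body_def edge_prologue_def edge_epilogue_def initialize_def
  load_def distance_def charge_def copy_def

lemma loop_free_small:
  "loop_free scan_body" "small scan_body" "loop_free edge_prologue" "small edge_prologue"
  "loop_free edge_epilogue" "small edge_epilogue" "loop_free initialize" "small initialize"
  by (simp_all add: program_defs)

definition charged :: "nat \<Rightarrow> nat \<Rightarrow> nat \<Rightarrow> nat \<Rightarrow> nat \<Rightarrow> nat" where
  "charged x y c w t = (let t' = (if x = w then if c \<noteq> 0 then 0 else t - 1 else t)
     in if y = w then if c \<noteq> 0 then 0 else t' - 1 else t')"

text \<open>The four charges read registers 15 and 16 before the distances overwrite them; both
  distances vanish iff the entry is the current edge.\<close>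

lemma scan_body_effect:
  assumes "\<forall>j. r j < B" "\<forall>j. m j < B" "r 14 + 3 < B"
  defines "x \<equiv> m (r 14)" and "y \<equiv> m (r 14 + 1)" and "c \<equiv> m (r 14 + 2)"
  obtains r' where "eval scan_body (r, m) = (r', m)"
    "r' 11 = (if x = r 7 \<and> y = r 8 then 0 else charged x y c (r 7) (r 11))"
    "r' 12 = charged x y c (r 8) (r 12)" "r' 13 = r 13 - 1" "r' 14 = r 14 + 3"
    "\<forall>i. i < 11 \<or> i = 20 \<longrightarrow> r' i = r i" "\<forall>j. r' j < B"
proof -
  have B: "r 14 + 0 < B" "r 14 + 1 < B" "r 14 + 2 < B" using assms(3) by auto
  have ne: "(7::nat) \<notin> {18, 19}" "(8::nat) \<notin> {18, 19}" "(11::nat) \<notin> {18, 19}"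
      "(12::nat) \<notin> {18, 19}" "(15::nat) \<notin> {18, 19}" "(16::nat) \<notin> {18, 19}"
    by simp_all
  obtain r1 where r1: "eval (load 15 14 0) (r, m) = (r1, m)" "r1 15 = m (r 14 + 0)"
    "\<forall>j. j \<noteq> 15 \<longrightarrow> j \<noteq> 18 \<longrightarrow> r1 j = r j" "\<forall>j. r1 j < B"
    by (rule load_effect[OF assms(1,2) B(1), where d = 15])
  obtain r2 where r2: "eval (load 16 14 1) (r1, m) = (r2, m)" "r2 16 = m (r1 14 + 1)"
    "\<forall>j. j \<noteq> 16 \<longrightarrow> j \<noteq> 18 \<longrightarrow> r2 j = r1 j" "\<forall>j. r2 j < B"
    using B(2) r1(3) by (auto intro: load_effect[OF r1(4) assms(2), where i = 14 and k = 1 and d = 16])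
  obtain r3 where r3: "eval (load 17 14 2) (r2, m) = (r3, m)" "r3 17 = m (r2 14 + 2)"
    "\<forall>j. j \<noteq> 17 \<longrightarrow> j \<noteq> 18 \<longrightarrow> r3 j = r2 j" "\<forall>j. r3 j < B"
    using B(3) r1(3) r2(3) by (auto intro: load_effect[OF r2(4) assms(2), where i = 14 and k = 2 and d = 17])
  obtain r4 where r4: "eval (charge 15 7 11) (r3, m) = (r4, m)"
    "r4 11 = (if r3 15 = r3 7 then if r3 17 \<noteq> 0 then 0 else r3 11 - 1 else r3 11)"
    "\<forall>l. l \<noteq> 11 \<longrightarrow> l \<noteq> 18 \<longrightarrow> l \<noteq> 19 \<longrightarrow> r4 l = r3 l" "\<forall>l. r4 l < B"
    by (rule charge_effect[OF r3(4) ne(5) ne(1) ne(3)])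
  obtain r5 where r5: "eval (charge 16 7 11) (r4, m) = (r5, m)"
    "r5 11 = (if r4 16 = r4 7 then if r4 17 \<noteq> 0 then 0 else r4 11 - 1 else r4 11)"
    "\<forall>l. l \<noteq> 11 \<longrightarrow> l \<noteq> 18 \<longrightarrow> l \<noteq> 19 \<longrightarrow> r5 l = r4 l" "\<forall>l. r5 l < B"
    by (rule charge_effect[OF r4(4) ne(6) ne(1) ne(3)])
  obtain r6 where r6: "eval (charge 15 8 12) (r5, m) = (r6, m)"
    "r6 12 = (if r5 15 = r5 8 then if r5 17 \<noteq> 0 then 0 else r5 12 - 1 else r5 12)"
    "\<forall>l. l \<noteq> 12 \<longrightarrow> l \<noteq> 18 \<longrightarrow> l \<noteq> 19 \<longrightarrow> r6 l = r5 l" "\<forall>l. r6 l < B"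
    by (rule charge_effect[OF r5(4) ne(5) ne(2) ne(4)])
  obtain r7 where r7: "eval (charge 16 8 12) (r6, m) = (r7, m)"
    "r7 12 = (if r6 16 = r6 8 then if r6 17 \<noteq> 0 then 0 else r6 12 - 1 else r6 12)"
    "\<forall>l. l \<noteq> 12 \<longrightarrow> l \<noteq> 18 \<longrightarrow> l \<noteq> 19 \<longrightarrow> r7 l = r6 l" "\<forall>l. r7 l < B"
    by (rule charge_effect[OF r6(4) ne(6) ne(2) ne(4)])
  obtain r8 where r8: "eval (distance 15 15 7) (r7, m) = (r8, m)" "r8 15 = (r7 15 - r7 7) + (r7 7 - r7 15)"
    "\<forall>l. l \<noteq> 15 \<longrightarrow> l \<noteq> 18 \<longrightarrow> l \<noteq> 19 \<longrightarrow> r8 l = r7 l" "\<forall>l. r8 l < B"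
    by (rule distance_effect[OF r7(4) ne(5) ne(1), where d = 15])
  obtain r9 where r9: "eval (distance 16 16 8) (r8, m) = (r9, m)" "r9 16 = (r8 16 - r8 8) + (r8 8 - r8 16)"
    "\<forall>l. l \<noteq> 16 \<longrightarrow> l \<noteq> 18 \<longrightarrow> l \<noteq> 19 \<longrightarrow> r9 l = r8 l" "\<forall>l. r9 l < B"
    by (rule distance_effect[OF r8(4) ne(6) ne(2), where d = 16])
  have keep: "r9 i = r i" if "i < 11 \<or> i = 13 \<or> i = 14 \<or> i = 20" for i
    using that by (auto simp: r9(3) r8(3) r7(3) r6(3) r5(3) r4(3) r3(3) r2(3) r1(3))
  have xyc: "r3 15 = x" "r3 16 = y" "r3 17 = c" "r3 7 = r 7" "r3 8 = r 8" "r3 11 = r 11" "r3 12 = r 12"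
    by (simp_all add: r1(2,3) r2(2,3) r3(2,3) x_def y_def c_def)
  have v11: "r9 11 = charged x y c (r 7) (r 11)"
    by (simp add: r4(2,3) r5(2,3) r6(3) r7(3) r8(3) r9(3) xyc charged_def)
  have v12: "r9 12 = charged x y c (r 8) (r 12)"
    by (simp add: r4(2,3) r5(2,3) r6(2,3) r7(2,3) r8(3) r9(3) xyc charged_def)
  have v15: "r9 15 = (x - r 7) + (r 7 - x)" and v16: "r9 16 = (y - r 8) + (r 8 - y)"
    by (simp_all add: r4(3) r5(3) r6(3) r7(3) r8(2,3) r9(2,3) xyc)
  let ?r = "r9(11 := if x = r 7 \<and> y = r 8 then 0 else r9 11, 14 := r 14 + 3, 13 := r 13 - 1)"
  show thesis
  proof (rule that)
    show "eval scan_body (r, m) = (?r, m)"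
      unfolding scan_body_def block.simps eval.simps r1(1) r2(1) r3(1) r4(1) r5(1) r6(1) r7(1) r8(1) r9(1)
      using v15 v16 keep[of 13] keep[of 14] by (simp add: copy_def)
    show "\<forall>j. ?r j < B"
      using r9(4) assms(1,3) by (auto intro: le_less_trans[OF diff_le_self] le_less_trans[OF le0])
  qed (use keep v11 v12 in auto)
qed

lemma edge_prologue_effect:
  assumes "\<forall>j. r j < B" "\<forall>j. m j < B" "r 6 + 3 < B" "m (r 6) + 2 < B" "m (r 6 + 1) + 2 < B" "r 20 + 1 < B"
  obtains r' where "eval edge_prologue (r, m) = (r', m)"
    "r' 7 = m (r 6)" "r' 8 = m (r 6 + 1)" "r' 9 = m (r 6 + 2)" "r' 10 = m (r 6 + 3)"
    "r' 11 = m (m (r 6) + 2)" "r' 12 = m (m (r 6 + 1) + 2)" "r' 13 = m (r 20)" "r' 14 = r 20 + 1"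
    "\<forall>i. i < 7 \<or> i = 20 \<longrightarrow> r' i = r i" "\<forall>j. r' j < B"
proof
  let ?r = "r(7 := m (r 6), 8 := m (r 6 + 1), 9 := m (r 6 + 2), 10 := m (r 6 + 3),
     11 := m (m (r 6) + 2), 12 := m (m (r 6 + 1) + 2), 13 := m (r 20), 14 := r 20 + 1, 18 := r 20)"
  show "eval edge_prologue (r, m) = (?r, m)"
    by (simp add: edge_prologue_def load_def copy_def fun_eq_iff)
  show "\<forall>j. ?r j < B"
    using assms by (simp add: less_imp_le)
qed auto

lemma edge_epilogue_effect:
  assumes "\<forall>j. r j < B" "r 3 * r 10 < B" "r 9 * r 4 < B" "r 6 + 4 < B" "1 < B"
  obtains r' where "eval edge_epilogue (r, m) = (r', m)"
    "if 0 < r 11 \<and> 0 < r 12 \<and> r 3 * r 10 \<le> r 9 * r 4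
     then r' 0 = 1 \<and> r' 1 = r 7 \<and> r' 2 = r 8 \<and> r' 3 = r 9 \<and> r' 4 = r 10
     else \<forall>i<5. r' i = r i"
    "r' 5 = r 5 - 1" "r' 6 = r 6 + 4" "r' 20 = r 20" "\<forall>j. r' j < B"
proof
  let ?s = "r(18 := r 3 * r 10 - r 9 * r 4, 19 := r 9 * r 4)"
  let ?r = "(if 0 < r 11 \<and> 0 < r 12 \<and> r 3 * r 10 \<le> r 9 * r 4
     then ?s(0 := 1, 1 := r 7, 2 := r 8, 3 := r 9, 4 := r 10) else ?s)(6 := r 6 + 4, 5 := r 5 - 1)"
  show "eval edge_epilogue (r, m) = (?r, m)"
    by (simp add: edge_epilogue_def copy_def fun_eq_iff)
  show "\<forall>j. ?r j < B"
    using assms by (auto intro: le_less_trans[OF diff_le_self])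
qed auto

lemma initialize_effect:
  assumes "\<forall>j. m j < B" "m 1 * 4 + (m 0 + 2) < B" "1 < B"
  obtains r' where "eval initialize (\<lambda>_. 0, m) = (r', m)"
    "r' 0 = 0" "r' 3 = 0" "r' 4 = 1" "r' 5 = m 1" "r' 6 = m 0 + 2" "r' 20 = m 1 * 4 + (m 0 + 2)" "\<forall>j. r' j < B"
proof
  let ?r = "(\<lambda>_. 0)(6 := m 0 + 2, 5 := m 1, 18 := 1, 20 := m 1 * 4 + (m 0 + 2), 4 := 1)"
  show "eval initialize (\<lambda>_. 0, m) = (?r, m)"
    by (simp add: initialize_def load_def copy_def fun_eq_iff)
  show "\<forall>j. ?r j < B" using assms by auto
qed auto

section \<open>Flattened lists, bit sizes and prefixes of histories\<close>

lemma nth_concat_uniform: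
  assumes "\<And>x. x \<in> set xs \<Longrightarrow> length (f x) = c" "i < length xs" "j < c"
  shows "concat (map f xs) ! (c * i + j) = f (xs ! i) ! j"
  using assms
proof (induction xs arbitrary: i)
  case (Cons x xs)
  then show ?case
    by (cases i) (auto simp: nth_append add.assoc)
qed simp

lemma length_concat_uniform:
  "(\<And>x. x \<in> set xs \<Longrightarrow> length (f x) = c) \<Longrightarrow> length (concat (map f xs)) = c * length xs"
  by (induction xs) auto

lemma length_le_bit_size: "length xs \<le> bit_size xs"
  by (induction xs) (auto simp: bit_size_def bit_length_def)

lemma less_power_bit_size: "x \<in> set xs \<Longrightarrow> x < 2 ^ bit_size xs"
proof -
  assume "x \<in> set xs"
  then have "bit_length x \<le> bit_size xs"
    unfolding bit_size_def by (intro member_le_sum_list) auto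
  then have "(2::nat) ^ bit_length x \<le> 2 ^ bit_size xs" by simp
  then show ?thesis using less_power_bit_length less_le_trans by blast
qed

lemma legal_snocE: "legal I (h @ [(e, b)]) \<Longrightarrow> legal I h \<and> probeable I h e"
  by (erule legal.cases) auto

lemma legal_appendD: "legal I (h @ h') \<Longrightarrow> legal I h"
proof (induction h' rule: rev_induct)
  case (snoc x h')
  then show ?case using legal_snocE[of I "h @ h'" "fst x" "snd x"] by simp
qed simp

text \<open>Since \<open>x \<noteq> y\<close>, at most one of the two successive charges hits a
  given vertex, so together they act like one probe.\<close>

lemma residual_snoc_charged:
  assumes "e = {x, y}" "x \<noteq> y"
  shows "residual I (h @ [(e, b)]) w = charged x y (of_bool b) w (residual I h w)"
  using assms by (auto simp: residual_snoc charged_def exhaust_def spend_def)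

lemma cross_multiply_trans:
  fixes a b c d e f :: nat
  assumes "a * d \<le> c * b" "c * f \<le> e * d" "0 < d"
  shows "a * f \<le> e * b"
proof -
  have "a * f * d = a * d * f" by simp
  also have "\<dots> \<le> c * b * f" using assms(1) by (rule mult_right_mono) simp
  also have "\<dots> = c * f * b" by simp
  also have "\<dots> \<le> e * d * b" using assms(2) by (rule mult_right_mono) simp
  also have "\<dots> = e * b * d" by simp
  finally show ?thesis using assms(3) by simp
qed

section \<open>The program on a fixed instance and history\<close>

locale greedy_run =
  fixes ts :: "nat list" and es :: "(nat \<times> nat \<times> nat \<times> nat) list"
    and I :: "nat sm_instance" and h :: "nat history"
  assumes wf: "sm_wf I" and desc: "describes (ts, es) I" and legal: "legal I h"
begin

definition memory :: "nat \<Rightarrow> nat" where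
  "memory = snd (initial_ram (encode_description (ts, es) @ encode_history h))"

abbreviation "n \<equiv> length ts"
abbreviation "M \<equiv> length es"
abbreviation "K \<equiv> length h"
abbreviation "H \<equiv> 2 + n + 4 * M"

definition "S = bit_size (encode_description (ts, es))"
text \<open>\<open>2 * S\<close> bits hold the products formed when fractions are compared, and also
  leave room for history addresses; 5 bits hold the program's own constants.\<close>

definition "L = 2 * S + 5"
definition "B = (2::nat) ^ L"

abbreviation "E \<equiv> concat (map (\<lambda>(u, v, a, b). [u, v, a, b]) es)"
abbreviation "T \<equiv> concat (map (\<lambda>(e, b). [Min e, Max e, of_bool b]) h)"

lemma length_E: "length E = 4 * M" and length_T: "length T = 3 * K"
  by (rule length_concat_uniform; auto)+

lemma memory_eq: "memory i = (let xs = [n, M] @ ts @ E @ [K] @ T in if i < length xs then xs ! i else 0)"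
  by (simp add: memory_def initial_ram_def encode_history_def Let_def)

lemma memory_sizes: "memory 0 = n" "memory 1 = M" "memory H = K"
  by (simp_all add: memory_eq Let_def nth_append length_E length_T)

lemma memory_patience: "v < n \<Longrightarrow> memory (v + 2) = ts ! v"
  by (simp add: memory_eq Let_def nth_append)

lemma memory_edge:
  assumes "i < M" "es ! i = (u, v, a, b)"
  shows "memory (2 + n + 4 * i) = u" "memory (2 + n + 4 * i + 1) = v"
    "memory (2 + n + 4 * i + 2) = a" "memory (2 + n + 4 * i + 3) = b"
proof -
  have m: "memory (2 + n + 4 * i + j) = E ! (4 * i + j)" if "j < 4" for j
    using that assms(1) by (simp add: memory_eq Let_def nth_append length_E length_T)
  have E: "E ! (4 * i + j) = [u, v, a, b] ! j" if "j < 4" for j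
    using that assms by (subst nth_concat_uniform) auto
  show "memory (2 + n + 4 * i) = u" "memory (2 + n + 4 * i + 1) = v"
    "memory (2 + n + 4 * i + 2) = a" "memory (2 + n + 4 * i + 3) = b"
    using m[of 0] m[of 1] m[of 2] m[of 3] E[of 0] E[of 1] E[of 2] E[of 3] by simp_all
qed

lemma memory_probe:
  assumes "j < K" "h ! j = (e, b)"
  shows "memory (H + 1 + 3 * j) = Min e" "memory (H + 1 + 3 * j + 1) = Max e"
    "memory (H + 1 + 3 * j + 2) = of_bool b"
proof -
  have m: "memory (H + 1 + 3 * j + l) = T ! (3 * j + l)" if "l < 3" for l
    using that assms(1) by (simp add: memory_eq Let_def nth_append length_E length_T)
  have T: "T ! (3 * j + l) = [Min e, Max e, of_bool b] ! l" if "l < 3" for l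
    using that assms by (subst nth_concat_uniform) auto
  show "memory (H + 1 + 3 * j) = Min e" "memory (H + 1 + 3 * j + 1) = Max e"
    "memory (H + 1 + 3 * j + 2) = of_bool b"
    using m[of 0] m[of 1] m[of 2] T[of 0] T[of 1] T[of 2] by simp_all
qed

lemma edges_eq: "edges I = (\<lambda>(u, v, a, b). {u, v}) ` set es"
  and verts_eq: "verts I = {..<n}"
  and patience_eq: "v < n \<Longrightarrow> patience I v = ts ! v"
  using desc by (auto simp: describes_def)

lemma edge_entry:
  assumes "(u, v, a, b) \<in> set es"
  shows "u < v" "v < n" "0 < b" "prob I {u, v} = real a / real b" "{u, v} \<in> edges I"
proof -
  show 1: "u < v" "0 < b" "prob I {u, v} = real a / real b"
    using desc assms by (auto simp: describes_def)
  show 2: "{u, v} \<in> edges I" using assms unfolding edges_eq by force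
  then have "{u, v} \<subseteq> verts I" using wf unfolding sm_wf_def by blast
  then show "v < n" by (simp add: verts_eq)
qed

lemma edge_Min_Max:
  assumes "e \<in> edges I"
  shows "Min e < Max e" "e = {Min e, Max e}" "Max e < n"
proof -
  obtain u v a b where q: "(u, v, a, b) \<in> set es" "e = {u, v}"
    using assms unfolding edges_eq by auto
  then have "u < v" "v < n" using edge_entry[OF q(1)] by auto
  then have "Min e = u" "Max e = v" using q(2) by auto
  then show "Min e < Max e" "e = {Min e, Max e}" "Max e < n"
    using q \<open>u < v\<close> \<open>v < n\<close> by auto
qed

text \<open>No edge is probed twice. This keeps the time bound a function of the instance alone,
  whatever the history.\<close>

lemma K_le_M: "K \<le> M"
proof -
  have "K \<le> card (edges I)"
    using legal_card[OF legal] wf by (metis card_mono finite_edges)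
  also have "\<dots> \<le> card (set es)" unfolding edges_eq by (rule card_image_le) simp
  also have "\<dots> \<le> M" by (rule card_length)
  finally show ?thesis .
qed

text \<open>Every number contributes at least one bit, so the list is no longer than its bit
  size.\<close>

lemma H_le: "H \<le> S"
  using length_le_bit_size[of "encode_description (ts, es)"] length_E by (simp add: S_def)

lemma description_less: "x \<in> set (encode_description (ts, es)) \<Longrightarrow> x < 2 ^ S"
  unfolding S_def by (rule less_power_bit_size)

lemma n_less: "n < 2 ^ S" and M_less: "M < 2 ^ S"
  by (rule description_less; simp)+

text \<open>\<open>S\<close> measures the description only, but a history adds nothing larger: its
  length is at most \<open>M\<close>, its vertices are below \<open>n\<close>, its outcomes at most
  1.\<close>

lemma memory_less: "memory i < 2 ^ S"
proof -
  have hist: "e \<in> edges I" if "(e, b) \<in> set h" for e b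
    using legal_card[OF legal] that by (force simp: image_iff)
  have contents: "x < 2 ^ S" if "x \<in> set ([n, M] @ ts @ E @ [K] @ T)" for x
  proof -
    have "\<exists>(e, b)\<in>set h. x = Min e \<or> x = Max e \<or> x = of_bool b" if "x \<in> set T"
      using that by force
    moreover have "x \<in> set (encode_description (ts, es)) \<or> x = K \<or> x \<in> set T"
      using that unfolding encode_description.simps set_append list.set by blast
    ultimately consider "x \<in> set (encode_description (ts, es))" | "x = K"
      | e b where "(e, b) \<in> set h" "x = Min e \<or> x = Max e \<or> x = of_bool b"
      by blast
    then show ?thesis
    proof cases
      case 1
      then show ?thesis by (rule description_less)
    next
      case 2
      then show ?thesis using K_le_M M_less by linarith
    next
      case 3
      have "2 \<le> S" using H_le by linarith
      then have "(2::nat) ^ 1 \<le> 2 ^ S" by (intro power_increasing) auto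
      moreover have "of_bool b \<le> (1::nat)" by simp
      ultimately show ?thesis
        using 3(2) edge_Min_Max[OF hist[OF 3(1)]] n_less by auto
    qed
  qed
  show ?thesis
  proof (cases "i < length ([n, M] @ ts @ E @ [K] @ T)")
    case True
    show ?thesis
      unfolding memory_eq Let_def if_P[OF True] by (rule contents[OF nth_mem[OF True]])
  next
    case False
    show ?thesis
      unfolding memory_eq Let_def if_not_P[OF False] by simp
  qed
qed

lemma S_power_le: "2 ^ S \<le> B" and prod_less: "x < 2 ^ S \<Longrightarrow> y < 2 ^ S \<Longrightarrow> x * y < B"
proof -
  show "2 ^ S \<le> B" unfolding B_def L_def by (rule power_increasing) auto
  assume "x < 2 ^ S" "y < 2 ^ S"
  then have "x * y < 2 ^ S * 2 ^ S" by (intro mult_strict_mono) auto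
  also have "\<dots> = 2 ^ (2 * S)" by (simp add: mult_2 power_add)
  also have "\<dots> \<le> B" unfolding B_def L_def by (rule power_increasing) auto
  finally show "x * y < B" .
qed

lemma memory_less_B: "\<forall>i. memory i < B"
  using memory_less S_power_le less_le_trans by blast

lemma address_less: "i \<le> L \<Longrightarrow> i < B"
  unfolding B_def using less_exp[of L] by linarith

lemma bits_below_L: "\<forall>i. r i < B \<Longrightarrow> bits_below L (r, memory)"
  using memory_less_B by (simp add: bits_below_def B_def)

lemma five_le_L: "5 \<le> L"
  by (simp add: L_def)

definition scan_inv :: "nat \<Rightarrow> nat \<Rightarrow> (nat \<Rightarrow> nat) \<Rightarrow> nat \<Rightarrow> ram \<Rightarrow> bool" where
  "scan_inv u v r0 j s \<longleftrightarrow> (\<exists>r. s = (r, memory) \<and> j \<le> K \<and> r 13 = j \<and> r 14 = H + 1 + 3 * (K - j) \<and>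
     (let h' = take (K - j) h in
       r 11 = (if {u, v} \<in> fst ` set h' then 0 else residual I h' u) \<and> r 12 = residual I h' v) \<and>
     (\<forall>i. i < 11 \<or> i = 20 \<longrightarrow> r i = r0 i) \<and> (\<forall>i. r i < B))"

text \<open>Zero is absorbing, so the mark of an already probed edge in register 11 survives all
  later entries.\<close>

lemma charged_0: "charged x y c w 0 = 0"
  by (simp add: charged_def)

lemma scan_step:
  assumes inv: "scan_inv u v r0 (Suc j) s" and uv: "r0 7 = u" "r0 8 = v" "u < v"
  shows "operand_val s (Reg 13) \<noteq> 0 \<and> runs_within scan_body s (cost_factor scan_body * L) (scan_inv u v r0 j)"
proof -
  let ?h = "take (K - Suc j) h"
  obtain r where s: "s = (r, memory)" and r: "Suc j \<le> K" "r 13 = Suc j" "r 14 = H + 1 + 3 * (K - Suc j)"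
      "r 11 = (if {u, v} \<in> fst ` set ?h then 0 else residual I ?h u)" "r 12 = residual I ?h v"
      "\<forall>i. i < 11 \<or> i = 20 \<longrightarrow> r i = r0 i" "\<forall>i. r i < B"
    using inv unfolding scan_inv_def Let_def by blast
  let ?j = "K - Suc j"
  have j: "?j < K" "K - j = Suc ?j" using r(1) by auto
  obtain e b where eb: "h ! ?j = (e, b)" by fastforce
  have h': "take (K - j) h = ?h @ [(e, b)]"
    unfolding j(2) take_Suc_conv_app_nth[OF j(1)] eb ..
  have "legal I (take (K - j) h @ drop (K - j) h)" using legal by simp
  then have "legal I (?h @ [(e, b)])" using legal_appendD unfolding h'[symmetric] by blast
  then have "probeable I ?h e" using legal_snocE by blast
  then have e: "e \<in> edges I" by (simp add: probeable_def)
  note xy = edge_Min_Max[OF e]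
  note mem = memory_probe[OF j(1) eb, folded r(3)]
  have "r 14 + 3 \<le> L" using r(3) j(1) K_le_M H_le L_def by linarith
  then have adr: "r 14 + 3 < B" by (rule address_less)
  obtain r' where r': "eval scan_body (r, memory) = (r', memory)"
    "r' 11 = (if Min e = r 7 \<and> Max e = r 8 then 0 else charged (Min e) (Max e) (of_bool b) (r 7) (r 11))"
    "r' 12 = charged (Min e) (Max e) (of_bool b) (r 8) (r 12)" "r' 13 = r 13 - 1" "r' 14 = r 14 + 3"
    "\<forall>i. i < 11 \<or> i = 20 \<longrightarrow> r' i = r i" "\<forall>j. r' j < B"
    using scan_body_effect[OF r(7) memory_less_B adr] unfolding mem by metis
  have uv': "r 7 = u" "r 8 = v" using r(6) uv by auto
  \<comment> \<open>Both edges are listed with the smaller endpoint first, so equality of sets is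
    equality in order.\<close>
  have eq: "e = {u, v} \<longleftrightarrow> Min e = u \<and> Max e = v"
    using xy uv(3) by (metis Max_in Min_eqI Min_in doubleton_eq_iff less_asym)
  have res: "residual I (?h @ [(e, b)]) w = charged (Min e) (Max e) (of_bool b) w (residual I ?h w)" for w
    using residual_snoc_charged xy by (metis less_irrefl)
  have "r' 11 = (if {u, v} \<in> fst ` set (?h @ [(e, b)]) then 0 else residual I (?h @ [(e, b)]) u)"
    unfolding res r'(2) uv' r(4) eq[symmetric] by (auto simp: charged_0)
  moreover have "r' 12 = residual I (?h @ [(e, b)]) v"
    unfolding res r'(3) uv' r(5) ..
  moreover have "r' 14 = H + 1 + 3 * (K - j)" using r'(5) r(3) j(2) by simp
  moreover have "r' 13 = j" using r'(4) r(2) by simp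
  ultimately have "scan_inv u v r0 j (r', memory)"
    unfolding scan_inv_def Let_def h' using r(1,6) r'(6,7) by auto
  then have "runs_within scan_body s (cost_factor scan_body * L) (scan_inv u v r0 j)"
    unfolding s using r'(1) bits_below_L[OF r(7)] loop_free_small by (intro runs_within_eval five_le_L) auto
  then show ?thesis using s r(2) by simp
qed

lemma scan_loop:
  assumes "scan_inv u v r0 K s" "r0 7 = u" "r0 8 = v" "u < v"
  shows "runs_within (While (Reg 13) scan_body) s ((K + 1) * (cost_factor scan_body * L + 3 * L)) (scan_inv u v r0 0)"
proof (rule runs_within_While[where Inv = "scan_inv u v r0", OF _ _ _ assms(1)])
  show "operand_cost s (Reg 13) \<le> 3 * L" if "scan_inv u v r0 j s" for j s
    using that bits_below_L unfolding scan_inv_def by (auto intro!: small_operand_cost five_le_L)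
  show "operand_val s (Reg 13) = 0" if "scan_inv u v r0 0 s" for s
    using that unfolding scan_inv_def by auto
qed (use scan_step assms in blast)

definition best :: "nat \<Rightarrow> (nat \<Rightarrow> nat) \<Rightarrow> bool" where
  "best i r \<longleftrightarrow>
     r 0 = 0 \<and> r 3 = 0 \<and> r 4 = 1 \<and> (\<forall>(u, v, a, b)\<in>set (take i es). \<not> probeable I h {u, v}) \<or>
     r 0 = 1 \<and> (r 1, r 2, r 3, r 4) \<in> set (take i es) \<and> probeable I h {r 1, r 2} \<and>
       (\<forall>(u, v, a, b)\<in>set (take i es). probeable I h {u, v} \<longrightarrow> a * r 4 \<le> r 3 * b)"

definition edge_inv :: "nat \<Rightarrow> ram \<Rightarrow> bool" where
  "edge_inv j s \<longleftrightarrow> (\<exists>r. s = (r, memory) \<and> j \<le> M \<and> r 5 = j \<and> r 6 = 2 + n + 4 * (M - j) \<and> r 20 = H \<and>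
     best (M - j) r \<and> (\<forall>i. r i < B))"

text \<open>The best fraction is either 0/1 or copied from the description, so its bit length does
  not grow from round to round.\<close>

lemma best_less: "best i r \<Longrightarrow> r 3 < 2 ^ S \<and> r 4 < 2 ^ S \<and> 0 < r 4"
proof -
  assume b: "best i r"
  have 1: "(1::nat) < 2 ^ S" using H_le by (intro one_less_power) auto
  show ?thesis
  proof (cases "r 0 = 0")
    case True
    then show ?thesis using b 1 by (auto simp: best_def)
  next
    case False
    then have q: "(r 1, r 2, r 3, r 4) \<in> set es"
      using b in_set_takeD by (fastforce simp: best_def)
    then have "r 3 \<in> set (encode_description (ts, es))" "r 4 \<in> set (encode_description (ts, es))"
      by force+
    then show ?thesis using edge_entry[OF q] description_less by blast
  qed
qed

lemma best_step:
  assumes b: "best i r" and i: "i < M" "es ! i = (u, v, a, b)"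
    and r': "if probeable I h {u, v} \<and> r 3 * b \<le> a * r 4
      then r' 0 = 1 \<and> r' 1 = u \<and> r' 2 = v \<and> r' 3 = a \<and> r' 4 = b else \<forall>i<5. r' i = r i"
  shows "best (Suc i) r'"
proof -
  have s: "set (take (Suc i) es) = insert (u, v, a, b) (set (take i es))"
    using i by (simp add: take_Suc_conv_app_nth)
  have r4: "0 < r 4" using best_less[OF b] by simp
  show ?thesis
  proof (cases "probeable I h {u, v} \<and> r 3 * b \<le> a * r 4")
    case True
    \<comment> \<open>The old best dominates all earlier entries and the new one dominates the old;
      transitivity cancels the positive denominator \<open>r 4\<close>.\<close>
    have le: "a' * b \<le> a * b'" if q: "(u', v', a', b') \<in> set (take i es)" "probeable I h {u', v'}" for u' v' a' b'
    proof (rule cross_multiply_trans[OF _ _ r4])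
      show "a' * r 4 \<le> r 3 * b'" using b q by (fastforce simp: best_def)
      show "r 3 * b \<le> a * r 4" using True by simp
    qed
    have r: "r' 0 = 1" "r' 1 = u" "r' 2 = v" "r' 3 = a" "r' 4 = b" using r' True by auto
    show ?thesis unfolding best_def s r using True le by auto
  next
    case False
    then have r: "r' 0 = r 0" "r' 1 = r 1" "r' 2 = r 2" "r' 3 = r 3" "r' 4 = r 4" using r' by auto
    show ?thesis using b False unfolding best_def s r by auto
  qed
qed

abbreviation "edge_cost \<equiv> cost_factor edge_prologue * L +
  ((K + 1) * (cost_factor scan_body * L + 3 * L) + cost_factor edge_epilogue * L)"

lemma edge_step:
  assumes inv: "edge_inv (Suc j) s"
  shows "operand_val s (Reg 5) \<noteq> 0 \<and> runs_within edge_body s edge_cost (edge_inv j)"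
proof -
  let ?i = "M - Suc j"
  obtain r where s: "s = (r, memory)" and r: "Suc j \<le> M" "r 5 = Suc j" "r 6 = 2 + n + 4 * ?i" "r 20 = H"
      "best ?i r" "\<forall>i. r i < B"
    using inv unfolding edge_inv_def by blast
  have i: "?i < M" "M - j = Suc ?i" using r(1) by auto
  obtain u v a b where q: "es ! ?i = (u, v, a, b)" by (metis prod_cases4)
  then have qs: "(u, v, a, b) \<in> set es" using i(1) by (metis nth_mem)
  note entry = edge_entry[OF qs]
  note mem = memory_edge[OF i(1) q, folded r(3)]
  have le: "r 6 + 4 \<le> L" "v + 2 \<le> L" "H + 1 \<le> L" using r(3) i(1) H_le entry(2) L_def by linarith+
  have less: "r 6 + 4 < B" "v + 2 < B" "H + 1 < B" using le by (blast intro: address_less)+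
  obtain r0 where r0: "eval edge_prologue (r, memory) = (r0, memory)"
    "r0 7 = u" "r0 8 = v" "r0 9 = a" "r0 10 = b" "r0 11 = memory (u + 2)" "r0 12 = memory (v + 2)"
    "r0 13 = memory (r 20)" "r0 14 = r 20 + 1" "\<forall>i. i < 7 \<or> i = 20 \<longrightarrow> r0 i = r i" "\<forall>j. r0 j < B"
    by (rule edge_prologue_effect[OF r(6) memory_less_B, unfolded mem]) (use less entry(1) r(4) in auto)
  have "u < n" using entry by simp
  have "residual I [] w = ts ! w" if "w < n" for w
    using that by (simp add: residual_def matching_def failed_probes_def patience_eq)
  then have "scan_inv u v r0 K (r0, memory)"
    unfolding scan_inv_def using r0 r(4) memory_sizes(3) memory_patience[OF \<open>u < n\<close>] memory_patience[OF entry(2)] \<open>u < n\<close> entry(2)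
    by simp
  moreover have "runs_within edge_prologue s (cost_factor edge_prologue * L) (\<lambda>s. s = (r0, memory))"
    unfolding s using r0(1) bits_below_L[OF r(6)] loop_free_small by (intro runs_within_eval five_le_L) auto
  moreover have "runs_within edge_epilogue s' (cost_factor edge_epilogue * L) (edge_inv j)"
    if s': "scan_inv u v r0 0 s'" for s'
  proof -
    obtain r1 where s1: "s' = (r1, memory)" and r1: 
        "r1 11 = (if {u, v} \<in> fst ` set h then 0 else residual I h u)" "r1 12 = residual I h v"
        "\<forall>i. i < 11 \<or> i = 20 \<longrightarrow> r1 i = r0 i" "\<forall>i. r1 i < B"
      using s' unfolding scan_inv_def Let_def by auto
    have keep: "r1 i = r i" if "i < 7 \<or> i = 20" for i using that r1(3) r0(10) by auto
    have k: "r1 3 = r 3" "r1 4 = r 4" "r1 5 = r 5" "r1 6 = r 6" "r1 20 = r 20" "r1 7 = u" "r1 8 = v" "r1 9 = a" "r1 10 = b"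
      using keep r1(3) r0(2-5) by auto
    have pr: "0 < r1 11 \<and> 0 < r1 12 \<longleftrightarrow> probeable I h {u, v}"
      using r1(1,2) entry(5) by (auto simp: probeable_iff unprobed_def)
    have ab: "a < 2 ^ S" "b < 2 ^ S" using mem(3,4) memory_less by metis+
    have "r1 3 * r1 10 < B" "r1 9 * r1 4 < B"
      unfolding k using best_less[OF r(5)] ab by (auto intro: prod_less)
    moreover have "r1 6 + 4 < B" "1 < B" using less k by auto
    ultimately obtain r2 where r2: "eval edge_epilogue (r1, memory) = (r2, memory)"
      "if 0 < r1 11 \<and> 0 < r1 12 \<and> r1 3 * r1 10 \<le> r1 9 * r1 4
       then r2 0 = 1 \<and> r2 1 = r1 7 \<and> r2 2 = r1 8 \<and> r2 3 = r1 9 \<and> r2 4 = r1 10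
       else \<forall>i<5. r2 i = r1 i"
      "r2 5 = r1 5 - 1" "r2 6 = r1 6 + 4" "r2 20 = r1 20" "\<forall>j. r2 j < B"
      using edge_epilogue_effect[OF r1(4), of memory] by metis
    have "best (Suc ?i) r2"
      by (rule best_step[OF r(5) i(1) q]) (use r2(2) keep pr in \<open>auto simp: k split: if_splits\<close>)
    then have "edge_inv j (r2, memory)"
      unfolding edge_inv_def i(2) using r2(3-6) k r(1-4) by auto
    then show ?thesis
      unfolding s1 using r2(1) bits_below_L[OF r1(4)] loop_free_small by (intro runs_within_eval five_le_L) auto
  qed
  ultimately have "runs_within edge_body s edge_cost (edge_inv j)"
    unfolding edge_body_def using scan_loop[OF _ r0(2,3) entry(1)]
    by (intro runs_within_Seq[where P = "\<lambda>s. s = (r0, memory)"] runs_within_Seq[where P = "scan_inv u v r0 0"]) auto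
  then show ?thesis using s r(2) by simp
qed

lemma edge_loop:
  assumes "edge_inv M s"
  shows "runs_within (While (Reg 5) edge_body) s ((M + 1) * (edge_cost + 3 * L)) (edge_inv 0)"
proof (rule runs_within_While[where Inv = edge_inv, OF _ _ _ assms])
  show "operand_cost s (Reg 5) \<le> 3 * L" if "edge_inv j s" for j s
    using that bits_below_L unfolding edge_inv_def by (auto intro!: small_operand_cost five_le_L)
  show "operand_val s (Reg 5) = 0" if "edge_inv 0 s" for s
    using that unfolding edge_inv_def by auto
qed (use edge_step in blast)

lemma program_runs:
  "runs_within greedy_program (\<lambda>_. 0, memory)
     (cost_factor initialize * L + (M + 1) * (edge_cost + 3 * L)) (edge_inv 0)"
  unfolding greedy_program_def
proof (rule runs_within_Seq[OF _ edge_loop])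
  have "memory 1 * 4 + (memory 0 + 2) \<le> L" using memory_sizes H_le L_def by simp
  then have less: "memory 1 * 4 + (memory 0 + 2) < B" by (rule address_less)
  have "1 < B" by (rule address_less) (simp add: L_def)
  then obtain r where r: "eval initialize (\<lambda>_. 0, memory) = (r, memory)"
    "r 0 = 0" "r 3 = 0" "r 4 = 1" "r 5 = memory 1" "r 6 = memory 0 + 2" "r 20 = memory 1 * 4 + (memory 0 + 2)" "\<forall>j. r j < B"
    by (rule initialize_effect[OF memory_less_B less])
  then have "edge_inv M (r, memory)"
    unfolding edge_inv_def using memory_sizes by (simp add: best_def)
  moreover have "bits_below L (\<lambda>_. 0, memory)"
    by (rule bits_below_L) (use \<open>1 < B\<close> in simp)
  ultimately show "runs_within initialize (\<lambda>_. 0, memory) (cost_factor initialize * L) (edge_inv M)"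
    by (intro runs_within_eval loop_free_small five_le_L) (simp_all add: r(1))
qed

lemma greedy_action:
  "\<exists>x T. next_action greedy_program (ts, es) h x T \<and>
     T \<le> cost_factor initialize * L + (M + 1) * (edge_cost + 3 * L) \<and>
     (case x of None \<Rightarrow> \<forall>e. \<not> probeable I h e
      | Some e \<Rightarrow> probeable I h e \<and> (\<forall>f. probeable I h f \<longrightarrow> prob I f \<le> prob I e))"
proof -
  obtain t r where t: "exec greedy_program (\<lambda>_. 0, memory) t (r, memory)"
      "t \<le> cost_factor initialize * L + (M + 1) * (edge_cost + 3 * L)" and b: "best M r"
    using program_runs by (auto simp: runs_within_def edge_inv_def)
  have init: "initial_ram (encode_description (ts, es) @ encode_history h) = (\<lambda>_. 0, memory)"
    by (simp add: memory_def initial_ram_def)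
  have entry: "\<exists>u v a b. (u, v, a, b) \<in> set es \<and> f = {u, v}" if "probeable I h f" for f
    using that unfolding probeable_def edges_eq by auto
  have "case decode_action (r, memory) of None \<Rightarrow> \<forall>e. \<not> probeable I h e
      | Some e \<Rightarrow> probeable I h e \<and> (\<forall>f. probeable I h f \<longrightarrow> prob I f \<le> prob I e)"
  proof (cases "r 0 = 0")
    case True
    then show ?thesis using b entry by (fastforce simp: decode_action_def best_def)
  next
    case False
    then have q: "(r 1, r 2, r 3, r 4) \<in> set es" and p: "probeable I h {r 1, r 2}"
      and max: "\<And>u v a b. (u, v, a, b) \<in> set es \<Longrightarrow> probeable I h {u, v} \<Longrightarrow> a * r 4 \<le> r 3 * b"
      using b by (auto simp: best_def)
    have "prob I f \<le> prob I {r 1, r 2}" if f: "probeable I h f" for f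
    proof -
      obtain u v a b where uv: "(u, v, a, b) \<in> set es" "f = {u, v}" using entry[OF f] by blast
      have "real (a * r 4) \<le> real (r 3 * b)" using max[OF uv(1)] f uv(2) by (intro of_nat_mono) auto
      then show ?thesis
        unfolding uv(2) edge_entry(4)[OF q] edge_entry(4)[OF uv(1)]
        using edge_entry(3)[OF q] edge_entry(3)[OF uv(1)] by (simp add: field_simps)
    qed
    then show ?thesis using False p by (simp add: decode_action_def)
  qed
  then show ?thesis using t init by (auto simp: next_action_def)
qed

text \<open>Two nested loops of at most \<open>L\<close> rounds, each step linear in
  \<open>L\<close>. The 6 collects the two loop tests of cost \<open>3 * L\<close>.\<close>

lemma time_bound:
  "cost_factor initialize * L + (M + 1) * (edge_cost + 3 * L) \<le>
    (cost_factor initialize + cost_factor edge_prologue + cost_factor scan_body + cost_factor edge_epilogue + 6) * L ^ 3"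
proof -
  let ?a = "cost_factor initialize" and ?b = "cost_factor edge_prologue"
    and ?c = "cost_factor scan_body" and ?d = "cost_factor edge_epilogue"
  have M: "M + 1 \<le> L" and K: "K + 1 \<le> L" using H_le K_le_M L_def by linarith+
  have "1 * L * L \<le> L * L * L" using five_le_L by (intro mult_right_mono) auto
  then have LL: "L \<le> L ^ 3" "L * L \<le> L ^ 3"
    using five_le_L by (simp_all add: power3_eq_cube)
  have "(K + 1) * (?c * L + 3 * L) \<le> L * (?c * L + 3 * L)" using K by (rule mult_right_mono) simp
  then have "edge_cost + 3 * L \<le> ?b * L + (L * (?c * L + 3 * L) + ?d * L) + 3 * L" by simp
  then have "(M + 1) * (edge_cost + 3 * L) \<le> L * (?b * L + (L * (?c * L + 3 * L) + ?d * L) + 3 * L)"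
    using M by (intro mult_mono) auto
  also have "\<dots> = (?b + ?d + 3) * (L * L) + (?c + 3) * L ^ 3"
    by (simp add: algebra_simps power3_eq_cube)
  also have "\<dots> \<le> (?b + ?d + 3) * L ^ 3 + (?c + 3) * L ^ 3"
    using LL by (intro add_mono mult_left_mono) auto
  finally have "?a * L + (M + 1) * (edge_cost + 3 * L) \<le> ?a * L ^ 3 + ((?b + ?d + 3) * L ^ 3 + (?c + 3) * L ^ 3)"
    using LL by (intro add_mono mult_left_mono) auto
  then show ?thesis by (simp add: algebra_simps)
qed

end

theorem theorem3:
  shows "\<exists>c. polynomial_time c \<and> approximation_algorithm 3.46 c"
proof (intro exI conjI)
  let ?C = "cost_factor initialize + cost_factor edge_prologue + cost_factor scan_body + cost_factor edge_epilogue + 6"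
  \<comment> \<open>The polynomial \<open>[:5, 2:]\<close> at \<open>S\<close> is \<open>L\<close>,
    so \<open>?q\<close> is the cubic of \<open>time_bound\<close>.\<close>
  let ?q = "smult ?C ([:5, 2:] ^ 3)"
  show "polynomial_time greedy_program"
    unfolding polynomial_time_def
  proof (intro exI[of _ ?q] allI impI)
    fix D :: description and I h
    assume *: "sm_wf I" "describes D I" "legal I h"
    obtain ts es where D: "D = (ts, es)" by (cases D)
    interpret greedy_run ts es I h using * D by unfold_locales auto
    have eq: "poly ?q (bit_size (encode_description D)) = ?C * L ^ 3"
      unfolding D L_def S_def poly_smult poly_power
      by (simp only: poly_pCons poly_0 mult_zero_right add_0_right mult.commute[of _ 2] add.commute[of _ 5])
    obtain x T where x: "next_action greedy_program D h x T"
        "T \<le> cost_factor initialize * L + (M + 1) * (edge_cost + 3 * L)"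
      using greedy_action unfolding D by blast
    have "T \<le> poly ?q (bit_size (encode_description D))"
      unfolding eq using x(2) time_bound by (rule order_trans)
    then show "\<exists>a T. next_action greedy_program D h a T \<and> T \<le> poly ?q (bit_size (encode_description D))"
      using x(1) by blast
  qed
  show "approximation_algorithm 3.46 greedy_program"
    unfolding approximation_algorithm_def
  proof (intro allI impI)
    fix D :: description and I
    assume *: "sm_wf I" "describes D I"
    obtain ts es where D: "D = (ts, es)" by (cases D)
    \<comment> \<open>Tying the machine's output to the greedy property in one predicate lets a
      single choice of \<sigma> be both computed by the program and greedy.\<close>
    define good where "good h x \<longleftrightarrow> (\<exists>T. next_action greedy_program D h x T) \<and>
       (case x of None \<Rightarrow> \<forall>e. \<not> probeable I h e
        | Some e \<Rightarrow> probeable I h e \<and> (\<forall>f. probeable I h f \<longrightarrow> prob I f \<le> prob I e))" for h x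
    have "\<exists>x. legal I h \<longrightarrow> good h x" for h
    proof (cases "legal I h")
      case True
      interpret greedy_run ts es I h using * D True by unfold_locales auto
      show ?thesis unfolding D good_def using greedy_action by blast
    qed simp
    then obtain \<sigma> where \<sigma>: "\<And>h. legal I h \<Longrightarrow> good h (\<sigma> h)" by metis
    have greedy: "greedy I \<sigma>"
      unfolding greedy_def[OF *(1)] using \<sigma> unfolding good_def by simp
    \<comment> \<open>The factor 2 is weakened to 3.46, which is sound because values are
      nonnegative.\<close>
    have "1 / 3.46 * strategy_value I \<tau> \<le> strategy_value I \<sigma>" if "valid_strategy I \<tau>" for \<tau>
      using greedy_two_approximation[OF *(1) greedy that] strategy_value_nonneg[of I \<sigma>] by simp
    then show "\<exists>\<sigma>. (\<forall>h. legal I h \<longrightarrow> (\<exists>T. next_action greedy_program D h (\<sigma> h) T)) \<and> valid_strategy I \<sigma> \<and>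
        (\<forall>\<tau>. valid_strategy I \<tau> \<longrightarrow> strategy_value I \<sigma> \<ge> 1 / 3.46 * strategy_value I \<tau>)"
      using \<sigma> greedy_valid[OF *(1) greedy] unfolding good_def by blast
  qed
qed

end
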